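(* Let $\mathcal H$ be a complex Hilbert space of finite dimension $n$ with $3\le n<+\infty$, and let $\phi:\mathcal P_1(\mathcal H)\to\mathcal P_1(\mathcal H)$ be a surjective map. Then the following are equivalent. (1) There exists an integer $k_0\ge n+1$ such that $\phi$ shrinks the joint spectrum of any $k_0$ rank one projections. (2) There exists an integer $k_0\ge n+1$ such that $\phi$ preserves the joint spectrum of any $k_0$ rank one projections. (3) For any integer $k\ge n+1$, $\phi$ shrinks the joint spectrum of any $k$ rank one projections. (4) For any integer $k\ge n+1$, $\phi$ preserves the joint spectrum of any $k$ rank one projections. (5) There exists a unitary or anti-unitary $U$ on $\mathcal H$ such that $\phi(P)=U^*PU$ for all $P\in\mathcal P_1(\mathcal H)$.
   Context: $\mathcal P_1(\mathcal H)$ denotes the set of all rank one (orthogonal) projections on $\mathcal H$. For operators $A_1,\dots,A_l$ on $\mathcal H$, the joint spectrum is $\sigma([A_1,\dots,A_l])=\{(c_1,\dots,c_l)\in\mathbb C^l: c_1A_1+\dots+c_lA_l\text{ is not invertible in }\mathcal B(\mathcal H)\}$. The map $\phi$ shrinks (respectively preserves) the joint spectrum of any $k$ rank one projections if $\sigma([\phi(P_1),\dots,\phi(P_k)])\subseteq\sigma([P_1,\dots,P_k])$ (respectively $=$) for all $P_1,\dots,P_k\in\mathcal P_1(\mathcal H)$. An anti-unitary is a conjugate-linear surjective isometry $U$ of $\mathcal H$; for it, $U^*=U^{-1}$. *)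

theory Defs
  imports "HOL-Analysis.Analysis"
begin

text \<open>Complex inner product spaces, with the inner product linear in its first argument. The
  class extends \<open>real_inner\<close>, whose real structure is tied to the complex one by the two
  compatibility axioms; in particular \<open>norm x = sqrt (Re (cinner x x))\<close>, and positive
  definiteness of \<open>cinner\<close> is inherited from \<open>inner\<close>.\<close>

class complex_inner = real_inner +
  fixes scaleC :: "complex \<Rightarrow> 'a \<Rightarrow> 'a"  (infixr "*\<^sub>C" 75)
    and cinner :: "'a \<Rightarrow> 'a \<Rightarrow> complex"
  assumes scaleC_add_right: "c *\<^sub>C (x + y) = c *\<^sub>C x + c *\<^sub>C y"
    and scaleC_add_left: "(c + d) *\<^sub>C x = c *\<^sub>C x + d *\<^sub>C x"
    and scaleC_scaleC: "c *\<^sub>C d *\<^sub>C x = (c * d) *\<^sub>C x"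
    and scaleC_of_real: "complex_of_real r *\<^sub>C x = r *\<^sub>R x"
    and cinner_commute: "cinner x y = cnj (cinner y x)"
    and cinner_add_left: "cinner (x + y) z = cinner x z + cinner y z"
    and cinner_scaleC_left: "cinner (c *\<^sub>C x) y = c * cinner x y"
    and Re_cinner: "Re (cinner x y) = inner x y"

class complex_hilbert = complex_inner + complete_space

lemma vector_space_scaleC:
  "vector_space (scaleC :: complex \<Rightarrow> 'a \<Rightarrow> 'a::complex_inner)"
proof
  show "1 *\<^sub>C x = x" for x :: 'a
    using scaleC_of_real[of 1 x] by simp
qed (simp_all add: scaleC_add_right scaleC_add_left scaleC_scaleC)

text \<open>The complex dimension; like \<open>card\<close>, it is \<open>0\<close> for infinite-dimensional subspaces, so a
  positive value entails finite dimension.\<close>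

definition cdim :: "'a::complex_inner set \<Rightarrow> nat" where
  "cdim = vector_space.dim scaleC"

definition bounded_clinear :: "('a::complex_inner \<Rightarrow> 'a) \<Rightarrow> bool" where
  "bounded_clinear T \<longleftrightarrow> bounded_linear T \<and> (\<forall>c x. T (c *\<^sub>C x) = c *\<^sub>C T x)"

definition invertible_op :: "('a::complex_inner \<Rightarrow> 'a) \<Rightarrow> bool" where
  "invertible_op T \<longleftrightarrow>
     bounded_clinear T \<and> (\<exists>S. bounded_clinear S \<and> S \<circ> T = id \<and> T \<circ> S = id)"

definition rank_one_projections :: "('a::complex_inner \<Rightarrow> 'a) set" where
  "rank_one_projections =
     {P. bounded_clinear P \<and> P \<circ> P = P \<and> (\<forall>x y. cinner (P x) y = cinner x (P y)) \<and>
         cdim (range P) = 1}"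

text \<open>Tuples of operators and of scalars are lists of equal length.\<close>

definition joint_spectrum :: "('a::complex_inner \<Rightarrow> 'a) list \<Rightarrow> complex list set" where
  "joint_spectrum As =
     {cs. length cs = length As \<and>
          \<not> invertible_op (\<lambda>x. \<Sum>i<length As. (cs ! i) *\<^sub>C (As ! i) x)}"

definition shrinks_joint_spectrum ::
    "(('a::complex_inner \<Rightarrow> 'a) \<Rightarrow> ('a \<Rightarrow> 'a)) \<Rightarrow> nat \<Rightarrow> bool" where
  "shrinks_joint_spectrum \<phi> k \<longleftrightarrow>
     (\<forall>Ps. length Ps = k \<and> set Ps \<subseteq> rank_one_projections \<longrightarrow>
           joint_spectrum (map \<phi> Ps) \<subseteq> joint_spectrum Ps)"

definition preserves_joint_spectrum ::
    "(('a::complex_inner \<Rightarrow> 'a) \<Rightarrow> ('a \<Rightarrow> 'a)) \<Rightarrow> nat \<Rightarrow> bool" where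
  "preserves_joint_spectrum \<phi> k \<longleftrightarrow>
     (\<forall>Ps. length Ps = k \<and> set Ps \<subseteq> rank_one_projections \<longrightarrow>
           joint_spectrum (map \<phi> Ps) = joint_spectrum Ps)"

text \<open>The Hilbert space adjoint, which exists for every bounded operator on a Hilbert space by
  the Riesz representation theorem. (The library's \<open>adjoint\<close> refers to the real inner product.)\<close>

definition cadjoint :: "('a::complex_inner \<Rightarrow> 'a) \<Rightarrow> ('a \<Rightarrow> 'a)" where
  "cadjoint T = (THE S. \<forall>x y. cinner (T x) y = cinner x (S y))"

definition unitary_op :: "('a::complex_inner \<Rightarrow> 'a) \<Rightarrow> bool" where
  "unitary_op U \<longleftrightarrow> bounded_clinear U \<and> cadjoint U \<circ> U = id \<and> U \<circ> cadjoint U = id"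

definition anti_unitary_op :: "('a::complex_inner \<Rightarrow> 'a) \<Rightarrow> bool" where
  "anti_unitary_op U \<longleftrightarrow>
     (\<forall>x y. U (x + y) = U x + U y) \<and> (\<forall>c x. U (c *\<^sub>C x) = cnj c *\<^sub>C U x) \<and>
     surj U \<and> (\<forall>x. norm (U x) = norm x)"

text \<open>The standard models \<open>complex ^ 'n\<close>, of dimension \<open>CARD('n)\<close>, are instances.\<close>

instantiation complex :: complex_inner
begin

definition scaleC_complex :: "complex \<Rightarrow> complex \<Rightarrow> complex" where
  "scaleC_complex c x = c * x"

definition cinner_complex :: "complex \<Rightarrow> complex \<Rightarrow> complex" where
  "cinner_complex x y = x * cnj y"

instance
  by standard
    (simp_all add: scaleC_complex_def cinner_complex_def algebra_simps inner_complex_def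
      scaleR_conv_of_real)

end

instance complex :: complex_hilbert ..

instantiation vec :: (complex_inner, finite) complex_inner
begin

definition scaleC_vec :: "complex \<Rightarrow> 'a ^ 'b \<Rightarrow> 'a ^ 'b" where
  "scaleC_vec c x = (\<chi> i. c *\<^sub>C (x $ i))"

definition cinner_vec :: "'a ^ 'b \<Rightarrow> 'a ^ 'b \<Rightarrow> complex" where
  "cinner_vec x y = (\<Sum>i\<in>UNIV. cinner (x $ i) (y $ i))"

instance
proof
  show "cinner x y = cnj (cinner y x)" for x y :: "'a ^ 'b"
    unfolding cinner_vec_def cnj_sum by (intro sum.cong refl cinner_commute)
qed (simp_all add: scaleC_vec_def cinner_vec_def vec_eq_iff scaleC_add_right scaleC_add_left
      scaleC_scaleC scaleC_of_real cinner_add_left cinner_scaleC_left Re_cinner inner_vec_def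
      sum.distrib sum_distrib_left)

end

instance vec :: (complex_hilbert, finite) complex_hilbert ..

end

theory Submission
  imports Defs
begin


text \<open>
  A rank one projection is \<open>proj u = x \<mapsto> \<langle>x,u\<rangle>u\<close> for a unit vector \<open>u\<close> that is unique up to a phase, so
  \<open>\<phi>\<close> acts through a map \<open>T\<close> of unit vectors with \<open>\<phi> (proj u) = proj (T u)\<close>. In finite dimension
  a combination of projections is invertible iff its kernel is trivial. Shrinking therefore means:
  if \<open>\<Sum>c\<^sub>i proj (T u\<^sub>i)\<close> has a nontrivial kernel, so has \<open>\<Sum>c\<^sub>i proj u\<^sub>i\<close>. Zero weights
  pass this on to every number \<open>m \<le> k\<^sub>0\<close> of projections (\<open>shrinks_singular_comb\<close>), and only
  \<open>m = n\<close> and \<open>m = n + 1\<close> are needed.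

  For \<open>n\<close> projections with all weights \<open>1\<close> the condition says that \<open>T\<close> maps bases to bases
  (\<open>total_image\<close>). Now add one more vector \<open>z = \<Sum>a\<^sub>i x\<^sub>i\<close> to a basis of unit vectors \<open>x\<^sub>i\<close>. The operator
  \<open>\<Sum>t\<^sub>i\<inverse> proj x\<^sub>i - proj z\<close> is singular exactly when \<open>\<Sum>|a\<^sub>i|\<^sup>2 t\<^sub>i = 1\<close>
  (\<open>singular_bordered_iff\<close>); so if \<open>T z = \<Sum>b\<^sub>i T x\<^sub>i\<close>, the hyperplane \<open>\<Sum>|b\<^sub>i|\<^sup>2 t\<^sub>i = 1\<close> lies in
  \<open>\<Sum>|a\<^sub>i|\<^sup>2 t\<^sub>i = 1\<close> as far as its points have no zero coordinate, which forces \<open>|a\<^sub>i| = |b\<^sub>i|\<close>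
  (\<open>coefficient_moduli\<close>). Thus \<open>T\<close> keeps the moduli of all expansion coefficients.

  Apply this to a unit vector \<open>z = s x + s \<theta> y\<close> whose phase \<open>\<theta>\<close> aligns the two summands, so that
  \<open>1 = s\<^sup>2 (2 + 2 |\<langle>x,y\<rangle>|)\<close>. Its image is a combination of \<open>T x\<close> and \<open>T y\<close> with coefficients of
  modulus \<open>s\<close>, and its norm is at most what aligned summands would give; hence
  \<open>|\<langle>x,y\<rangle>| \<le> |\<langle>T x,T y\<rangle>|\<close> (\<open>cinner_le_image\<close>). Surjectivity turns this into an equality:
  an orthonormal basis containing \<open>T y\<close> pulls back to unit vectors which, by the inequality, are again
  orthonormal, and the two Parseval sums for \<open>x\<close> and \<open>T x\<close> are both \<open>1\<close>
  (\<open>transition_preserving_if_surj\<close>).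

  What remains is Wigner's theorem, proved here by hand in coordinates. The phases of an image
  basis \<open>f\<close> of an orthonormal basis \<open>e\<close> are fixed by the image of \<open>\<Sum>e\<^sub>i\<close>; testing against
  \<open>e\<^sub>i + e\<^sub>j\<close> and \<open>e\<^sub>i + \<i>e\<^sub>j\<close> shows that each entry of the matrix \<open>(u\<^sub>i cnj u\<^sub>j)\<close> is kept or conjugated,
  the choice being independent of \<open>u\<close>, and \<open>e\<^sub>i + \<i>e\<^sub>j - e\<^sub>k\<close> excludes that both kinds occur
  (\<open>wigner_bases\<close>). The two cases give a unitary and an anti-unitary operator.

  Conversely, unitary conjugation clearly keeps singularity, and anti-unitary conjugation replaces
  the weights by their conjugates, that is, the operator by its adjoint, which is
  singular together with it (\<open>singular_comb_cnj\<close>).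
\<close>

section \<open>Complex inner products and orthonormal bases\<close>

interpretation cvs: vector_space "scaleC :: complex \<Rightarrow> 'a \<Rightarrow> 'a::complex_inner"
  by (rule vector_space_scaleC)

abbreviation clinear :: "('a::complex_inner \<Rightarrow> 'a) \<Rightarrow> bool" where
  "clinear \<equiv> Vector_Spaces.linear scaleC scaleC"

lemma clinear_iff:
  "clinear f \<longleftrightarrow> (\<forall>x y. f (x + y) = f x + f y) \<and> (\<forall>c x. f (c *\<^sub>C x) = c *\<^sub>C f x)"
  by (simp add: Vector_Spaces.linear_iff vector_space_scaleC)

lemma cinner_add_right: "cinner x (y + z) = cinner x y + cinner x z"
  by (subst (1 2 3) cinner_commute) (simp add: cinner_add_left)

lemma cinner_scaleC_right: "cinner x (c *\<^sub>C y) = cnj c * cinner x y"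
  by (subst (1 2) cinner_commute) (simp add: cinner_scaleC_left)

lemma cinner_zero_left [simp]: "cinner 0 x = 0"
  using cinner_scaleC_left[of 0 x x] by simp

lemma cinner_zero_right [simp]: "cinner x 0 = 0"
  by (subst cinner_commute) simp

lemma cinner_minus_left: "cinner (- x) y = - cinner x y"
  using cinner_add_left[of x "- x" y] by (simp add: eq_neg_iff_add_eq_0 add.commute)

lemma cinner_diff_left: "cinner (x - y) z = cinner x z - cinner y z"
  using cinner_add_left[of x "- y" z] by (simp add: cinner_minus_left)

lemma cinner_minus_right: "cinner x (- y) = - cinner x y"
  by (subst (1 2) cinner_commute) (simp add: cinner_minus_left)

lemma cinner_diff_right: "cinner x (y - z) = cinner x y - cinner x z"
  by (subst (1 2 3) cinner_commute) (simp add: cinner_diff_left)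

lemma cinner_sum_left: "cinner (sum f A) x = (\<Sum>i\<in>A. cinner (f i) x)"
  by (induction A rule: infinite_finite_induct) (simp_all add: cinner_add_left)

lemma cinner_sum_right: "cinner x (sum f A) = (\<Sum>i\<in>A. cinner x (f i))"
  by (induction A rule: infinite_finite_induct) (simp_all add: cinner_add_right)

lemma cinner_self: "cinner x x = complex_of_real ((norm x)\<^sup>2)"
proof (rule complex_eqI)
  show "Re (cinner x x) = Re (complex_of_real ((norm x)\<^sup>2))"
    by (simp add: Re_cinner power2_norm_eq_inner)
  have "Im (cinner x x) = Im (cnj (cinner x x))"
    using cinner_commute[of x x] by simp
  then show "Im (cinner x x) = Im (complex_of_real ((norm x)\<^sup>2))"
    by simp
qed

lemma cinner_eq_zero [simp]: "cinner x x = 0 \<longleftrightarrow> x = 0"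
  by (simp add: cinner_self)

lemma norm_scaleC: "norm (c *\<^sub>C x) = cmod c * norm (x::'a::complex_inner)"
proof -
  have "complex_of_real ((norm (c *\<^sub>C x))\<^sup>2) = (c * cnj c) * complex_of_real ((norm x)\<^sup>2)"
    unfolding cinner_self[symmetric] by (simp add: cinner_scaleC_left cinner_scaleC_right)
  also have "\<dots> = complex_of_real ((cmod c * norm x)\<^sup>2)"
    by (simp add: complex_norm_square[symmetric] power_mult_distrib)
  finally have "(norm (c *\<^sub>C x))\<^sup>2 = (cmod c * norm x)\<^sup>2"
    by (simp only: of_real_eq_iff)
  then show ?thesis by simp
qed

lemma cmod_cinner_commute: "cmod (cinner x y) = cmod (cinner y x)"
  by (subst cinner_commute) simp

definition orthonormal :: "nat \<Rightarrow> (nat \<Rightarrow> 'a::complex_inner) \<Rightarrow> bool" where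
  "orthonormal m e \<longleftrightarrow> (\<forall>i<m. \<forall>j<m. cinner (e i) (e j) = (if i = j then 1 else 0))"

definition onb :: "nat \<Rightarrow> (nat \<Rightarrow> 'a::complex_inner) \<Rightarrow> bool" where
  "onb n e \<longleftrightarrow> orthonormal n e \<and> (\<forall>x. x = (\<Sum>i<n. cinner x (e i) *\<^sub>C e i))"

lemma onb_expand: "onb n e \<Longrightarrow> x = (\<Sum>i<n. cinner x (e i) *\<^sub>C e i)"
  by (auto simp: onb_def)

lemma onb_orthonormal: "onb n e \<Longrightarrow> orthonormal n e"
  by (auto simp: onb_def)

lemma orthonormal_cinner:
  "\<lbrakk>orthonormal m e; i < m; j < m\<rbrakk> \<Longrightarrow> cinner (e i) (e j) = (if i = j then 1 else 0)"
  by (simp add: orthonormal_def)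

lemma orthonormal_cinner_comb:
  assumes "orthonormal m e" "j < m"
  shows "cinner (\<Sum>i<m. a i *\<^sub>C e i) (e j) = a j"
proof -
  have "cinner (\<Sum>i<m. a i *\<^sub>C e i) (e j) = (\<Sum>i<m. if i = j then a i else 0)"
    unfolding cinner_sum_left using assms
    by (intro sum.cong) (auto simp: cinner_scaleC_left orthonormal_def)
  then show ?thesis using assms by simp
qed

lemma orthonormal_norm:
  assumes "orthonormal m e" "i < m"
  shows "norm (e i) = 1"
proof -
  have "complex_of_real ((norm (e i))\<^sup>2) = complex_of_real 1"
    unfolding cinner_self[symmetric] using assms by (simp add: orthonormal_def)
  then have "(norm (e i))\<^sup>2 = 1"
    by (simp only: of_real_eq_iff)
  then show ?thesis using norm_ge_zero[of "e i"] by (auto simp: power2_eq_1_iff)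
qed

lemma onb_cinner:
  assumes "onb n e"
  shows "cinner x y = (\<Sum>i<n. cinner x (e i) * cnj (cinner y (e i)))"
proof -
  have "cinner x y = cinner (\<Sum>i<n. cinner x (e i) *\<^sub>C e i) y"
    using onb_expand[OF assms, of x] by simp
  also have "\<dots> = (\<Sum>i<n. cinner x (e i) * cnj (cinner y (e i)))"
    unfolding cinner_sum_left cinner_scaleC_left
    by (intro sum.cong refl arg_cong2[where f="(*)"] cinner_commute)
  finally show ?thesis .
qed

lemma onb_norm_sq:
  assumes "onb n e"
  shows "(norm x)\<^sup>2 = (\<Sum>i<n. (cmod (cinner x (e i)))\<^sup>2)"
proof -
  have "complex_of_real ((norm x)\<^sup>2) = complex_of_real (\<Sum>i<n. (cmod (cinner x (e i)))\<^sup>2)"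
    using onb_cinner[OF assms, of x x] unfolding cinner_self
    by (simp add: complex_norm_square[symmetric])
  then show ?thesis by (simp only: of_real_eq_iff)
qed

lemma onb_eqI:
  assumes "onb n e" "\<And>i. i < n \<Longrightarrow> cinner x (e i) = cinner y (e i)"
  shows "x = y"
  using onb_expand[OF assms(1), of x] onb_expand[OF assms(1), of y] assms(2) by simp

lemma orthonormal_independent:
  assumes "orthonormal m e"
  shows "cvs.independent (e ` {..<m})" "card (e ` {..<m}) = m"
proof -
  have inj: "inj_on e {..<m}"
  proof (rule inj_onI)
    fix i j assume ij: "i \<in> {..<m}" "j \<in> {..<m}" "e i = e j"
    have "cinner (e i) (e i) = 1"
      using assms ij by (simp add: orthonormal_def)
    then have "cinner (e i) (e j) = 1"
      using ij by simp
    moreover have "cinner (e i) (e j) = (if i = j then 1 else 0)"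
      using assms ij(1,2) by (simp add: orthonormal_def)
    ultimately show "i = j" by (simp split: if_splits)
  qed
  then show "card (e ` {..<m}) = m"
    by (simp add: card_image)
  show "cvs.independent (e ` {..<m})"
  proof (rule cvs.independent_if_scalars_zero)
    fix f x assume s: "(\<Sum>x\<in>e ` {..<m}. f x *\<^sub>C x) = 0" and x: "x \<in> e ` {..<m}"
    from x obtain j where j: "j < m" "x = e j" by auto
    have "(\<Sum>i<m. f (e i) *\<^sub>C e i) = 0"
      using s by (simp add: sum.reindex[OF inj])
    with orthonormal_cinner_comb[OF assms j(1), of "\<lambda>i. f (e i)"] j
    show "f x = 0" by simp
  qed simp
qed

lemma finite_dimensional:
  assumes "cdim (UNIV :: 'a::complex_inner set) = n" "n > 0"
  obtains B :: "'a::complex_inner set"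
  where "finite_dimensional_vector_space scaleC B" "card B = n"
proof -
  obtain B :: "'a set" where "B \<subseteq> UNIV" and B: "cvs.independent B" "UNIV \<subseteq> cvs.span B" "card B = cvs.dim (UNIV :: 'a set)"
    by (rule cvs.basis_exists)
  then have "card B = n" using assms by (simp add: cdim_def)
  moreover have "finite_dimensional_vector_space scaleC B"
  proof unfold_locales
    show "finite B" using \<open>card B = n\<close> assms(2) by (simp add: card_ge_0_finite)
    show "cvs.independent B" by (rule B(1))
    show "cvs.span B = UNIV" using B(2) by blast
  qed
  ultimately show ?thesis using that by blast
qed

lemma clinear_inj_imp_surj:
  fixes f :: "'a::complex_inner \<Rightarrow> 'a"
  assumes "cdim (UNIV :: 'a set) = n" "n > 0" "clinear f" "\<And>x. f x = 0 \<Longrightarrow> x = 0"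
  shows "surj f"
proof -
  obtain B :: "'a set" where "finite_dimensional_vector_space scaleC B"
    using finite_dimensional[OF assms(1,2)] .
  then interpret fd: finite_dimensional_vector_space "scaleC :: complex \<Rightarrow> 'a \<Rightarrow> 'a" B .
  interpret f: Vector_Spaces.linear "scaleC :: complex \<Rightarrow> 'a \<Rightarrow> 'a" scaleC f by fact
  have "inj f"
    using assms(4) f.inj_iff_eq_0 by blast
  then show ?thesis
    using fd.linear_inj_imp_surj[OF assms(3)] by blast
qed

lemma orthonormal_le_cdim:
  assumes "cdim (UNIV :: 'a::complex_inner set) = n" "n > 0"
    and "orthonormal m (e :: nat \<Rightarrow> 'a)"
  shows "m \<le> n"
proof -
  obtain B :: "'a set" where "finite_dimensional_vector_space scaleC B" and B: "card B = n"
    using finite_dimensional[OF assms(1,2)] .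
  then interpret fd: finite_dimensional_vector_space "scaleC :: complex \<Rightarrow> 'a \<Rightarrow> 'a" B by simp
  have "card (e ` {..<m}) \<le> cvs.dim (UNIV :: 'a set)"
    by (rule fd.independent_card_le_dim) (simp_all add: orthonormal_independent(1)[OF assms(3)])
  then show ?thesis using assms(1) orthonormal_independent(2)[OF assms(3)] by (simp add: cdim_def)
qed

lemma orthonormal_residual:
  assumes "orthonormal m e" "j < m"
  shows "cinner (x - (\<Sum>i<m. cinner x (e i) *\<^sub>C e i)) (e j) = 0"
  by (simp add: cinner_diff_left orthonormal_cinner_comb[OF assms])

lemma orthonormal_snoc:
  assumes "orthonormal m e" "norm u = 1" "\<And>j. j < m \<Longrightarrow> cinner u (e j) = 0"
  shows "orthonormal (Suc m) (e(m := u))"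
proof -
  have uu: "cinner u u = 1" by (simp add: cinner_self assms(2))
  have "cinner (e j) u = 0" if "j < m" for j
    by (subst cinner_commute) (simp add: assms(3) that)
  then show ?thesis
    using assms(1,3) uu unfolding orthonormal_def less_Suc_eq by auto
qed

lemma norm_normalized: "r \<noteq> 0 \<Longrightarrow> norm (complex_of_real (1 / norm r) *\<^sub>C (r::'a::complex_inner)) = 1"
  by (simp add: norm_scaleC norm_divide)

text \<open>A vector outside the expansion would have a residual which, normalized, extends the family to
  \<open>n + 1\<close> orthonormal vectors, too many for the dimension.\<close>

lemma orthonormal_cdim_onb:
  assumes d: "cdim (UNIV :: 'a::complex_inner set) = n" "n > 0"
    and o: "orthonormal n (e :: nat \<Rightarrow> 'a)"
  shows "onb n e"
  unfolding onb_def
proof (intro conjI allI o)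
  fix x
  define r where "r = x - (\<Sum>i<n. cinner x (e i) *\<^sub>C e i)"
  have "r = 0"
  proof (rule ccontr)
    assume "r \<noteq> 0"
    have "orthonormal (Suc n) (e(n := complex_of_real (1 / norm r) *\<^sub>C r))"
      by (intro orthonormal_snoc o norm_normalized \<open>r \<noteq> 0\<close>)
        (simp add: cinner_scaleC_left r_def orthonormal_residual[OF o])
    from orthonormal_le_cdim[OF d this] show False by simp
  qed
  then show "x = (\<Sum>i<n. cinner x (e i) *\<^sub>C e i)" by (simp add: r_def)
qed

lemma orthonormal_extend:
  assumes d: "cdim (UNIV :: 'a::complex_inner set) = n" "n > 0"
    and o: "orthonormal m (e :: nat \<Rightarrow> 'a)" and mn: "m < n"
  obtains u where "orthonormal (Suc m) (e(m := u))"
proof -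
  have "\<exists>x. x \<noteq> (\<Sum>i<m. cinner x (e i) *\<^sub>C e i)"
  proof (rule ccontr)
    assume "\<nexists>x. x \<noteq> (\<Sum>i<m. cinner x (e i) *\<^sub>C e i)"
    then have *: "x = (\<Sum>i<m. cinner x (e i) *\<^sub>C e i)" for x by blast
    have "UNIV \<subseteq> cvs.span (e ` {..<m})"
    proof
      fix x
      have "(\<Sum>i<m. cinner x (e i) *\<^sub>C e i) \<in> cvs.span (e ` {..<m})"
        by (intro cvs.span_sum cvs.span_scale cvs.span_base) auto
      then show "x \<in> cvs.span (e ` {..<m})" using *[of x] by simp
    qed
    then have "cvs.dim (UNIV :: 'a set) \<le> card (e ` {..<m})"
      by (rule cvs.dim_le_card) simp
    also have "\<dots> \<le> m" using card_image_le[of "{..<m}" e] by simp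
    finally show False using d mn by (simp add: cdim_def)
  qed
  then obtain x where x: "x \<noteq> (\<Sum>i<m. cinner x (e i) *\<^sub>C e i)" by blast
  define r where "r = x - (\<Sum>i<m. cinner x (e i) *\<^sub>C e i)"
  have "r \<noteq> 0" using x by (simp add: r_def)
  have "orthonormal (Suc m) (e(m := complex_of_real (1 / norm r) *\<^sub>C r))"
    by (intro orthonormal_snoc o norm_normalized \<open>r \<noteq> 0\<close>)
      (simp add: cinner_scaleC_left r_def orthonormal_residual[OF o])
  then show ?thesis by (rule that)
qed

lemma exists_onb:
  assumes d: "cdim (UNIV :: 'a::complex_inner set) = n" "n > 0"
    and u: "norm (u :: 'a) = 1"
  obtains e where "onb n e" "e 0 = u"
proof -
  have "\<exists>e. orthonormal m e \<and> e 0 = u" if "1 \<le> m" "m \<le> n" for m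
    using that
  proof (induction m rule: dec_induct)
    case base
    have "orthonormal 1 (\<lambda>_. u)"
      by (simp add: orthonormal_def cinner_self u)
    then show ?case by (intro exI[of _ "\<lambda>_. u"]) simp
  next
    case (step m)
    then obtain e where e: "orthonormal m e" "e 0 = u" by auto
    from step have "m < n" by simp
    from orthonormal_extend[OF d e(1) this] obtain v where "orthonormal (Suc m) (e(m := v))" .
    moreover have "(e(m := v)) 0 = u" using e step by simp
    ultimately show ?case by blast
  qed
  from this[of n] d obtain e where "orthonormal n e" "e 0 = u" by auto
  with orthonormal_cdim_onb[OF d] that show ?thesis by blast
qed

lemma exists_unit:
  assumes d: "cdim (UNIV :: 'a::complex_inner set) = n" "n > 0"
  obtains u :: "'a::complex_inner" where "norm u = 1"
proof -
  have "orthonormal 0 (\<lambda>_. 0 :: 'a)" by (simp add: orthonormal_def)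
  then obtain u :: 'a where "orthonormal (Suc 0) ((\<lambda>_. 0)(0 := u))"
    using orthonormal_extend[OF d _ d(2)] by blast
  from orthonormal_norm[OF this, of 0] that show ?thesis by simp
qed

lemma clinear_bounded:
  fixes f :: "'a::complex_inner \<Rightarrow> 'a"
  assumes d: "cdim (UNIV :: 'a set) = n" "n > 0" and f: "clinear f"
  shows "bounded_clinear f"
proof -
  obtain u :: 'a where "norm u = 1" using exists_unit[OF d] .
  then obtain e :: "nat \<Rightarrow> 'a" where e: "onb n e" using exists_onb[OF d] by blast
  interpret f: Vector_Spaces.linear "scaleC :: complex \<Rightarrow> 'a \<Rightarrow> 'a" scaleC f by fact
  have "bounded_linear f"
  proof (rule bounded_linear_intro[where K = "\<Sum>i<n. norm (f (e i))"])
    show "f (x + y) = f x + f y" for x y by (rule f.add)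
    show "f (r *\<^sub>R x) = r *\<^sub>R f x" for r x
      unfolding scaleC_of_real[symmetric] by (rule f.scale)
    show "norm (f x) \<le> norm x * (\<Sum>i<n. norm (f (e i)))" for x
    proof -
      have "f x = (\<Sum>i<n. cinner x (e i) *\<^sub>C f (e i))"
        using arg_cong[OF onb_expand[OF e, of x], of f] by (simp add: f.sum f.scale)
      also have "norm \<dots> \<le> (\<Sum>i<n. norm x * norm (f (e i)))"
      proof (rule sum_norm_le)
        fix i assume i: "i \<in> {..<n}"
        have "(cmod (cinner x (e i)))\<^sup>2 \<le> (norm x)\<^sup>2"
          unfolding onb_norm_sq[OF e, of x] by (rule member_le_sum) (use i in auto)
        then have "cmod (cinner x (e i)) \<le> norm x"
          by (rule power2_le_imp_le) simp
        then show "norm (cinner x (e i) *\<^sub>C f (e i)) \<le> norm x * norm (f (e i))"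
          by (simp add: norm_scaleC mult_right_mono)
      qed
      finally show ?thesis by (simp add: sum_distrib_left)
    qed
  qed
  then show ?thesis by (simp add: bounded_clinear_def f.scale)
qed

lemma bounded_clinear_clinear: "bounded_clinear f \<Longrightarrow> clinear f"
  unfolding bounded_clinear_def clinear_iff
  using bounded_linear.linear linear_add by blast

text \<open>This turns every statement about joint spectra into one about kernels: in finite dimension an
  injective linear map is bijective and its inverse is automatically bounded.\<close>

lemma invertible_op_iff_kernel:
  fixes f :: "'a::complex_inner \<Rightarrow> 'a"
  assumes d: "cdim (UNIV :: 'a set) = n" "n > 0" and f: "clinear f"
  shows "invertible_op f \<longleftrightarrow> (\<forall>x. f x = 0 \<longrightarrow> x = 0)"
proof
  assume "invertible_op f"
  then obtain S where S: "bounded_clinear S" "S \<circ> f = id"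
    by (auto simp: invertible_op_def)
  interpret S: Vector_Spaces.linear "scaleC :: complex \<Rightarrow> 'a \<Rightarrow> 'a" scaleC S
    using bounded_clinear_clinear[OF S(1)] .
  show "\<forall>x. f x = 0 \<longrightarrow> x = 0"
  proof (intro allI impI)
    fix x assume "f x = 0"
    then have "S (f x) = 0" by simp
    with S(2) show "x = 0" by (metis comp_apply id_apply)
  qed
next
  assume k: "\<forall>x. f x = 0 \<longrightarrow> x = 0"
  interpret f: Vector_Spaces.linear "scaleC :: complex \<Rightarrow> 'a \<Rightarrow> 'a" scaleC f by fact
  have "bij f"
    using clinear_inj_imp_surj[OF d f] k f.inj_iff_eq_0 by (auto simp: bij_def)
  then have l: "inv f (f x) = x" and r: "f (inv f x) = x" for x
    by (auto simp: bij_is_inj bij_is_surj surj_f_inv_f)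
  have "clinear (inv f)"
    unfolding clinear_iff
  proof safe
    show "inv f (x + y) = inv f x + inv f y" for x y
      using l[of "inv f x + inv f y"] by (simp add: f.add r)
    show "inv f (c *\<^sub>C x) = c *\<^sub>C inv f x" for c x
      using l[of "c *\<^sub>C inv f x"] by (simp add: f.scale r)
  qed
  then show "invertible_op f"
    unfolding invertible_op_def using clinear_bounded[OF d] f l r
    by (intro conjI exI[of _ "inv f"]) (auto simp: fun_eq_iff)
qed


section \<open>Rank one projections and singular combinations of them\<close>

definition proj :: "'a::complex_inner \<Rightarrow> 'a \<Rightarrow> 'a" where
  "proj u x = cinner x u *\<^sub>C u"

lemma clinear_proj: "clinear (proj u)"
  unfolding clinear_iff proj_def
  by (simp add: cinner_add_left cinner_scaleC_left scaleC_add_left scaleC_scaleC)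

lemma norm_proj: "norm u = 1 \<Longrightarrow> norm (proj u x) = cmod (cinner x u)"
  by (simp add: proj_def norm_scaleC)

lemma proj_in_rank_one_projections:
  fixes u :: "'a::complex_inner"
  assumes d: "cdim (UNIV :: 'a set) = n" "n > 0" and u: "norm u = 1"
  shows "proj u \<in> rank_one_projections"
proof -
  have uu: "cinner u u = 1" by (simp add: cinner_self u)
  have "u \<noteq> 0" using u by auto
  have "range (proj u) = cvs.span {u}"
  proof -
    have "k *\<^sub>C u = proj u (k *\<^sub>C u)" for k
      by (simp add: proj_def cinner_scaleC_left uu)
    then have "cvs.span {u} \<subseteq> range (proj u)"
      unfolding cvs.span_singleton by (intro image_subsetI) (rule range_eqI)
    moreover have "range (proj u) \<subseteq> cvs.span {u}"
      unfolding cvs.span_singleton by (auto simp: proj_def)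
    ultimately show ?thesis by blast
  qed
  moreover have "cvs.dim (cvs.span {u}) = 1"
    using cvs.dim_span_eq_card_independent[of "{u}"] \<open>u \<noteq> 0\<close> by simp
  moreover have "proj u \<circ> proj u = proj u"
    by (rule ext) (simp add: proj_def cinner_scaleC_left uu)
  moreover have "cinner (proj u x) y = cinner x (proj u y)" for x y
    using cinner_commute[of u y] by (simp add: proj_def cinner_scaleC_left cinner_scaleC_right)
  ultimately show ?thesis
    unfolding rank_one_projections_def cdim_def
    using clinear_bounded[OF d clinear_proj] by simp
qed

text \<open>The range is spanned by a unit vector \<open>u\<close> fixed by \<open>P\<close>, and self-adjointness identifies the
  coefficient of \<open>P x\<close> as \<open>\<langle>P x,u\<rangle> = \<langle>x,P u\<rangle> = \<langle>x,u\<rangle>\<close>.\<close>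

lemma rank_one_projection_is_proj:
  fixes P :: "'a::complex_inner \<Rightarrow> 'a"
  assumes "P \<in> rank_one_projections"
  obtains u where "norm u = 1" "P = proj u"
proof -
  have P: "bounded_clinear P" "P \<circ> P = P" "\<And>x y. cinner (P x) y = cinner x (P y)"
      "cvs.dim (range P) = 1"
    using assms by (auto simp: rank_one_projections_def cdim_def)
  obtain B where B: "B \<subseteq> range P" "cvs.independent B" "range P \<subseteq> cvs.span B"
      "card B = cvs.dim (range P)"
    by (rule cvs.basis_exists)
  then obtain b where b: "B = {b}" using P(4) by (auto simp: card_1_singleton_iff)
  have "b \<noteq> 0" using B(2) b cvs.dependent_zero[of B] by auto
  define u where "u = complex_of_real (1 / norm b) *\<^sub>C b"
  have nu: "norm u = 1" unfolding u_def by (rule norm_normalized[OF \<open>b \<noteq> 0\<close>])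
  have "P b = b" using B(1) b P(2) by (auto simp: fun_eq_iff)
  then have Pu: "P u = u" using P(1) by (simp add: u_def bounded_clinear_def)
  have "P x = proj u x" for x
  proof -
    obtain k where "P x = k *\<^sub>C b" using B(3) b by (auto simp: cvs.span_singleton)
    also have "b = complex_of_real (norm b) *\<^sub>C u"
      using \<open>b \<noteq> 0\<close> by (simp add: u_def)
    finally obtain c where c: "P x = c *\<^sub>C u" by (auto simp: scaleC_scaleC)
    have "c = cinner (P x) u" by (simp add: c cinner_scaleC_left cinner_self nu)
    also have "\<dots> = cinner x u" by (simp add: P(3) Pu)
    finally show ?thesis by (simp add: c proj_def)
  qed
  with nu that show ?thesis by blast
qed

definition rank_one_sum ::
  "nat \<Rightarrow> (nat \<Rightarrow> complex) \<Rightarrow> (nat \<Rightarrow> 'a::complex_inner) \<Rightarrow> 'a \<Rightarrow> 'a" where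
  "rank_one_sum m c u x = (\<Sum>i<m. c i *\<^sub>C proj (u i) x)"

lemma rank_one_sum_add: "rank_one_sum m c u (x + y) = rank_one_sum m c u x + rank_one_sum m c u y"
  by (simp add: rank_one_sum_def proj_def cinner_add_left scaleC_add_left scaleC_add_right sum.distrib)

lemma rank_one_sum_scaleC: "rank_one_sum m c u (k *\<^sub>C x) = k *\<^sub>C rank_one_sum m c u x"
  by (simp add: rank_one_sum_def proj_def cinner_scaleC_left cvs.scale_sum_right scaleC_scaleC mult_ac)

lemma clinear_rank_one_sum: "clinear (rank_one_sum m c u)"
  by (simp add: clinear_iff rank_one_sum_add rank_one_sum_scaleC)

lemma rank_one_sum_zero [simp]: "rank_one_sum m c u 0 = 0"
  by (simp add: rank_one_sum_def proj_def)

lemma cinner_rank_one_sum: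
  "cinner (rank_one_sum m c u x) y = (\<Sum>i<m. c i * cinner x (u i) * cinner (u i) y)"
  by (simp add: rank_one_sum_def proj_def cinner_sum_left cinner_scaleC_left mult_ac)

lemma rank_one_sum_adjoint:
  "cinner (rank_one_sum m c u x) y = cinner x (rank_one_sum m (\<lambda>i. cnj (c i)) u y)"
proof -
  have "cinner x (rank_one_sum m (\<lambda>i. cnj (c i)) u y)
      = cnj (cinner (rank_one_sum m (\<lambda>i. cnj (c i)) u y) x)"
    by (rule cinner_commute)
  also have "\<dots> = (\<Sum>i<m. c i * cnj (cinner y (u i)) * cnj (cinner (u i) x))"
    by (simp add: cinner_rank_one_sum)
  also have "\<dots> = (\<Sum>i<m. c i * cinner (u i) y * cinner x (u i))"
    by (simp only: cinner_commute[of "u _" y, symmetric] cinner_commute[of x "u _", symmetric])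
  finally show ?thesis by (simp add: cinner_rank_one_sum mult_ac)
qed

text \<open>Joint spectra are studied through this predicate on unit vectors rather than on lists of
  operators: zero weights can then be appended freely.\<close>

definition singular_comb ::
  "nat \<Rightarrow> (nat \<Rightarrow> complex) \<Rightarrow> (nat \<Rightarrow> 'a::complex_inner) \<Rightarrow> bool" where
  "singular_comb m c u \<longleftrightarrow> (\<exists>x. x \<noteq> 0 \<and> rank_one_sum m c u x = 0)"

text \<open>Conjugating the weights gives the adjoint. If an operator has trivial kernel it is onto, and
  then a kernel vector of the adjoint is orthogonal to everything.\<close>

lemma singular_comb_cnj:
  fixes u :: "nat \<Rightarrow> 'a::complex_inner"
  assumes d: "cdim (UNIV :: 'a set) = n" "n > 0"
  shows "singular_comb m (\<lambda>i. cnj (c i)) u \<longleftrightarrow> singular_comb m c u"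
proof -
  have *: "singular_comb m c u" if s: "singular_comb m (\<lambda>i. cnj (c i)) u" for c
  proof (rule ccontr)
    assume "\<not> singular_comb m c u"
    then have "surj (rank_one_sum m c u)"
      by (intro clinear_inj_imp_surj[OF d clinear_rank_one_sum]) (auto simp: singular_comb_def)
    moreover obtain x where x: "x \<noteq> 0" "rank_one_sum m (\<lambda>i. cnj (c i)) u x = 0"
      using s by (auto simp: singular_comb_def)
    ultimately obtain y where y: "x = rank_one_sum m c u y" by (auto simp: surj_def)
    have "cinner x x = cinner (rank_one_sum m c u y) x" using y by simp
    also have "\<dots> = 0" by (simp only: rank_one_sum_adjoint x cinner_zero_right)
    finally have "cinner x x = 0" .
    with x show False by simp
  qed
  show ?thesis using *[of c] *[of "\<lambda>i. cnj (c i)"] by auto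
qed

lemma joint_spectrum_proj:
  fixes u :: "nat \<Rightarrow> 'a::complex_inner"
  assumes d: "cdim (UNIV :: 'a set) = n" "n > 0"
  shows "cs \<in> joint_spectrum (map (\<lambda>i. proj (u i)) [0..<m])
    \<longleftrightarrow> length cs = m \<and> singular_comb m (nth cs) u"
proof -
  have "(\<lambda>x. \<Sum>i<m. (cs ! i) *\<^sub>C (map (\<lambda>i. proj (u i)) [0..<m] ! i) x) = rank_one_sum m (nth cs) u"
    by (rule ext) (simp add: rank_one_sum_def)
  then show ?thesis
    by (auto simp: joint_spectrum_def singular_comb_def
        invertible_op_iff_kernel[OF d clinear_rank_one_sum])
qed

lemma projection_list:
  fixes Ps :: "('a::complex_inner \<Rightarrow> 'a) list"
  assumes "set Ps \<subseteq> rank_one_projections"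
  obtains u where "Ps = map (\<lambda>i. proj (u i)) [0..<length Ps]" "\<And>i. i < length Ps \<Longrightarrow> norm (u i) = 1"
proof -
  have "\<exists>u. norm u = 1 \<and> Ps ! i = proj u" if "i < length Ps" for i
  proof -
    from that assms have "Ps ! i \<in> rank_one_projections" by auto
    then show ?thesis by (rule rank_one_projection_is_proj) blast
  qed
  then obtain u where "\<And>i. i < length Ps \<Longrightarrow> norm (u i) = 1 \<and> Ps ! i = proj (u i)" by metis
  then show ?thesis by (intro that[of u]) (auto intro!: nth_equalityI)
qed

text \<open>A combination of rank one projections may be padded with projections of zero weight, so
  shrinking the joint spectrum of \<open>k\<close> projections implies the same for fewer.\<close>

lemma shrinks_singular_comb:
  fixes \<phi> :: "('a::complex_inner \<Rightarrow> 'a) \<Rightarrow> ('a \<Rightarrow> 'a)"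
  assumes d: "cdim (UNIV :: 'a set) = n" "n > 0"
    and \<phi>: "shrinks_joint_spectrum \<phi> k" and mk: "m \<le> k" "0 < m"
    and T: "\<And>u. norm u = 1 \<Longrightarrow> \<phi> (proj u) = proj (T u)"
    and u: "\<And>i. i < m \<Longrightarrow> norm (u i) = 1"
    and s: "singular_comb m c (\<lambda>i. T (u i))"
  shows "singular_comb m c u"
proof -
  define w where "w i = (if i < m then u i else u 0)" for i
  define c' where "c' i = (if i < m then c i else 0)" for i
  have pad: "rank_one_sum k c' v = rank_one_sum m c v'" if "\<And>i. i < m \<Longrightarrow> v i = v' i" for v v' :: "nat \<Rightarrow> 'a"
  proof (rule ext)
    fix x
    have "(\<Sum>i<k. c' i *\<^sub>C proj (v i) x) = (\<Sum>i<m. c' i *\<^sub>C proj (v i) x)"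
      by (rule sum.mono_neutral_right) (use mk in \<open>auto simp: c'_def\<close>)
    also have "\<dots> = (\<Sum>i<m. c i *\<^sub>C proj (v' i) x)"
      by (intro sum.cong refl) (auto simp: c'_def that)
    finally show "rank_one_sum k c' v x = rank_one_sum m c v' x" by (simp add: rank_one_sum_def)
  qed
  define cs where "cs = map c' [0..<k]"
  have cs: "rank_one_sum k (nth cs) v = rank_one_sum k c' v" for v :: "nat \<Rightarrow> 'a"
    by (rule ext) (simp add: rank_one_sum_def cs_def)
  have w: "norm (w i) = 1" for i using u mk by (simp add: w_def)
  define Ps where "Ps = map (\<lambda>i. proj (w i)) [0..<k]"
  have "length Ps = k \<and> set Ps \<subseteq> rank_one_projections"
    using w by (auto simp: Ps_def intro: proj_in_rank_one_projections[OF d])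
  then have "joint_spectrum (map \<phi> Ps) \<subseteq> joint_spectrum Ps"
    using \<phi> by (auto simp: shrinks_joint_spectrum_def)
  moreover have "map \<phi> Ps = map (\<lambda>i. proj (T (w i))) [0..<k]"
    using w by (simp add: Ps_def T)
  moreover have "singular_comb k (nth cs) (\<lambda>i. T (w i))"
    using s unfolding singular_comb_def cs
    by (subst pad[of "\<lambda>i. T (w i)" "\<lambda>i. T (u i)"]) (simp_all add: w_def)
  then have "cs \<in> joint_spectrum (map (\<lambda>i. proj (T (w i))) [0..<k])"
    by (simp only: joint_spectrum_proj[OF d]) (simp add: cs_def)
  ultimately have "cs \<in> joint_spectrum Ps" by auto
  then have "singular_comb k (nth cs) w"
    unfolding Ps_def joint_spectrum_proj[OF d] by simp
  then show ?thesis
    unfolding singular_comb_def cs by (subst (asm) pad[of w u]) (simp_all add: w_def)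
qed

section \<open>Unitary and anti-unitary conjugations preserve joint spectra\<close>

lemma preserves_joint_spectrumI:
  fixes \<phi> :: "('a::complex_inner \<Rightarrow> 'a) \<Rightarrow> ('a \<Rightarrow> 'a)"
  assumes d: "cdim (UNIV :: 'a set) = n" "n > 0"
    and T: "\<And>u. norm u = 1 \<Longrightarrow> \<phi> (proj u) = proj (T u)"
    and s: "\<And>c u. singular_comb k c (\<lambda>i. T (u i)) \<longleftrightarrow> singular_comb k c u"
  shows "preserves_joint_spectrum \<phi> k"
  unfolding preserves_joint_spectrum_def
proof (intro allI impI, elim conjE)
  fix Ps :: "('a \<Rightarrow> 'a) list" assume Ps: "length Ps = k" "set Ps \<subseteq> rank_one_projections"
  obtain u where u: "Ps = map (\<lambda>i. proj (u i)) [0..<length Ps]" "\<And>i. i < length Ps \<Longrightarrow> norm (u i) = 1"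
    by (rule projection_list[OF Ps(2)]) blast
  have "map \<phi> Ps = map (\<lambda>i. proj (T (u i))) [0..<k]"
    by (subst u(1)) (use u(2) Ps(1) in \<open>simp add: T\<close>)
  moreover have "Ps = map (\<lambda>i. proj (u i)) [0..<k]" using u(1) Ps(1) by simp
  moreover have "joint_spectrum (map (\<lambda>i. proj (T (u i))) [0..<k])
      = joint_spectrum (map (\<lambda>i. proj (u i)) [0..<k])"
    by (rule set_eqI) (simp only: joint_spectrum_proj[OF d] s)
  ultimately show "joint_spectrum (map \<phi> Ps) = joint_spectrum Ps" by (simp only:)
qed

lemma cadjoint_eqI:
  fixes U :: "'a::complex_inner \<Rightarrow> 'a"
  assumes "\<And>x y. cinner (U x) y = cinner x (S y)"
  shows "cadjoint U = S"
  unfolding cadjoint_def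
proof (rule the_equality)
  fix S' assume S': "\<forall>x y. cinner (U x) y = cinner x (S' y)"
  show "S' = S"
  proof
    fix y
    have "cinner x (S' y - S y) = 0" for x
      unfolding cinner_diff_right S'[rule_format, symmetric] assms by simp
    then have "S' y - S y = 0" using cinner_eq_zero by blast
    then show "S' y = S y" by simp
  qed
qed (use assms in blast)

text \<open>The description of \<open>cadjoint\<close> by \<open>THE\<close> is only usable once an adjoint is known to exist; in an
  orthonormal basis it is \<open>y \<mapsto> \<Sum>\<langle>y, U e\<^sub>i\<rangle> e\<^sub>i\<close>.\<close>

lemma cinner_cadjoint:
  fixes U :: "'a::complex_inner \<Rightarrow> 'a"
  assumes d: "cdim (UNIV :: 'a set) = n" "n > 0" and U: "clinear U"
  shows "cinner (U x) y = cinner x (cadjoint U y)"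
proof -
  obtain u :: 'a where "norm u = 1" using exists_unit[OF d] .
  then obtain e :: "nat \<Rightarrow> 'a" where e: "onb n e" using exists_onb[OF d] by blast
  interpret U: Vector_Spaces.linear "scaleC :: complex \<Rightarrow> 'a \<Rightarrow> 'a" scaleC U by fact
  define S where "S y = (\<Sum>i<n. cinner y (U (e i)) *\<^sub>C e i)" for y
  have *: "cinner (U x) y = cinner x (S y)" for x y
  proof -
    have "cinner (U x) y = cinner (U (\<Sum>i<n. cinner x (e i) *\<^sub>C e i)) y"
      using onb_expand[OF e, of x] by simp
    also have "\<dots> = (\<Sum>i<n. cinner x (e i) * cinner (U (e i)) y)"
      by (simp add: U.sum U.scale cinner_sum_left cinner_scaleC_left)
    also have "\<dots> = (\<Sum>i<n. cnj (cinner y (U (e i))) * cinner x (e i))"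
      by (simp only: cinner_commute[of "U _" y] mult.commute)
    finally show ?thesis
      by (simp add: S_def cinner_sum_right cinner_scaleC_right)
  qed
  then show ?thesis using cadjoint_eqI[of U S] by simp
qed

text \<open>Since \<open>U\<^sup>* (proj u) U = proj (U\<^sup>* u)\<close>, the second clause is the invariance of kernels under the
  similarity by \<open>U\<close>.\<close>

lemma unitary_conjugation_proj:
  fixes U :: "'a::complex_inner \<Rightarrow> 'a"
  assumes d: "cdim (UNIV :: 'a set) = n" "n > 0" and U: "unitary_op U"
  shows "cadjoint U \<circ> proj u \<circ> U = proj (cadjoint U u)"
    and "singular_comb k c (\<lambda>i. cadjoint U (u' i)) \<longleftrightarrow> singular_comb k c u'"
proof -
  have cl: "clinear U" using U by (simp add: unitary_op_def bounded_clinear_clinear)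
  note ad = cinner_cadjoint[OF d cl]
  have VU: "cadjoint U (U x) = x" and UV: "U (cadjoint U x) = x" for x
    using U by (auto simp: unitary_op_def fun_eq_iff)
  interpret U: Vector_Spaces.linear "scaleC :: complex \<Rightarrow> 'a \<Rightarrow> 'a" scaleC U by (rule cl)
  have V: "cadjoint U (s *\<^sub>C x) = s *\<^sub>C cadjoint U x" for s x
    using VU[of "s *\<^sub>C cadjoint U x"] by (simp add: U.scale UV)
  show "cadjoint U \<circ> proj u \<circ> U = proj (cadjoint U u)"
    by (rule ext) (simp add: proj_def V ad)
  have "U (rank_one_sum k c (\<lambda>i. cadjoint U (u' i)) x) = rank_one_sum k c u' (U x)" for x
    by (simp add: rank_one_sum_def proj_def U.sum U.scale UV ad)
  moreover have "U x = 0 \<longleftrightarrow> x = 0" for x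
    using VU[of x] VU[of 0] U.zero by metis
  ultimately have "x \<noteq> 0 \<and> rank_one_sum k c (\<lambda>i. cadjoint U (u' i)) x = 0
      \<longleftrightarrow> U x \<noteq> 0 \<and> rank_one_sum k c u' (U x) = 0" for x
    by metis
  then show "singular_comb k c (\<lambda>i. cadjoint U (u' i)) \<longleftrightarrow> singular_comb k c u'"
    unfolding singular_comb_def by (metis UV)
qed

text \<open>Polarization: preservation of norms gives the real parts, and the imaginary part of
  \<open>\<langle>x,y\<rangle>\<close> is the real part of \<open>\<langle>x,\<i>y\<rangle>\<close>, where conjugate-linearity brings in the sign.\<close>

lemma anti_unitary_cinner:
  assumes U: "anti_unitary_op U"
  shows "cinner (U x) (U y) = cnj (cinner x y)"
proof -
  have add: "U (x + y) = U x + U y" and sc: "U (c *\<^sub>C x) = cnj c *\<^sub>C U x" and nm: "norm (U x) = norm x"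
    for c x y using U by (auto simp: anti_unitary_op_def)
  have Re: "Re (cinner (U x) (U y)) = Re (cinner x y)" for x y
    using nm[of "x + y"] nm[of x] nm[of y]
    unfolding add Re_cinner by (metis dot_norm)
  have "Im (cinner (U x) (U y)) = - Im (cinner x y)"
    using Re[of x "\<i> *\<^sub>C y"] by (simp add: sc cinner_scaleC_right cinner_minus_right)
  with Re show ?thesis by (simp add: complex_eq_iff)
qed

text \<open>Here \<open>U\<close> intertwines the combination with weights \<open>c\<close> and the one with weights \<open>cnj c\<close>; the
  latter is the adjoint of what is wanted.\<close>

lemma anti_unitary_conjugation_proj:
  fixes U :: "'a::complex_inner \<Rightarrow> 'a"
  assumes d: "cdim (UNIV :: 'a set) = n" "n > 0" and U: "anti_unitary_op U"
  shows "inv U \<circ> proj u \<circ> U = proj (inv U u)"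
    and "singular_comb k c (\<lambda>i. inv U (u' i)) \<longleftrightarrow> singular_comb k c u'"
proof -
  have add: "U (x + y) = U x + U y" and sc: "U (c *\<^sub>C x) = cnj c *\<^sub>C U x" and nm: "norm (U x) = norm x"
    and "surj U"
    for c x y using U by (auto simp: anti_unitary_op_def)
  have UV: "U (inv U x) = x" for x using \<open>surj U\<close> by (simp add: surj_f_inv_f)
  have U0: "U x = 0 \<longleftrightarrow> x = 0" for x using nm[of x] by (metis norm_eq_zero)
  have inj: "x = y" if "U x = U y" for x y
  proof -
    have "U (x - y) + U y = U x" by (simp add: add[symmetric])
    with that have "U (x - y) = 0" by simp
    then show ?thesis by (simp add: U0)
  qed
  then have VU: "inv U (U x) = x" for x using UV by blast
  have ad: "cinner (U x) v = cnj (cinner x (inv U v))" for x v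
    using anti_unitary_cinner[OF U, of x "inv U v"] by (simp add: UV)
  have "U ((inv U \<circ> proj u \<circ> U) x) = U (proj (inv U u) x)" for x
    by (simp add: proj_def sc UV ad)
  then show "inv U \<circ> proj u \<circ> U = proj (inv U u)"
    using inj by blast
  have "U (sum f A) = (\<Sum>i\<in>A. U (f i))" for f and A :: "nat set"
    by (induction A rule: infinite_finite_induct) (simp_all add: add U0)
  then have "U (rank_one_sum k c (\<lambda>i. inv U (u' i)) x) = rank_one_sum k (\<lambda>i. cnj (c i)) u' (U x)" for x
    by (simp add: rank_one_sum_def proj_def sc UV ad)
  then have "x \<noteq> 0 \<and> rank_one_sum k c (\<lambda>i. inv U (u' i)) x = 0
      \<longleftrightarrow> U x \<noteq> 0 \<and> rank_one_sum k (\<lambda>i. cnj (c i)) u' (U x) = 0" for x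
    by (metis U0)
  then have "singular_comb k c (\<lambda>i. inv U (u' i)) \<longleftrightarrow> singular_comb k (\<lambda>i. cnj (c i)) u'"
    unfolding singular_comb_def by (metis UV)
  then show "singular_comb k c (\<lambda>i. inv U (u' i)) \<longleftrightarrow> singular_comb k c u'"
    by (simp add: singular_comb_cnj[OF d])
qed


section \<open>Total families and the moduli of expansion coefficients\<close>

text \<open>Among \<open>n\<close> vectors in dimension \<open>n\<close> these are the bases. Having only the zero vector orthogonal to
  all of them is the form in which singular combinations detect a basis.\<close>

definition total_family :: "nat \<Rightarrow> (nat \<Rightarrow> 'a::complex_inner) \<Rightarrow> bool" where
  "total_family n x \<longleftrightarrow> (\<forall>v. (\<forall>i<n. cinner v (x i) = 0) \<longrightarrow> v = 0)"

lemma total_family_iff_not_singular: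
  "total_family n x \<longleftrightarrow> \<not> singular_comb n (\<lambda>_. 1) x"
proof -
  have "rank_one_sum n (\<lambda>_. 1) x v = 0 \<longleftrightarrow> (\<forall>i<n. cinner v (x i) = 0)" for v
  proof
    assume "rank_one_sum n (\<lambda>_. 1) x v = 0"
    then have "0 = cinner (rank_one_sum n (\<lambda>_. 1) x v) v" by simp
    also have "\<dots> = (\<Sum>i<n. cinner v (x i) * cnj (cinner v (x i)))"
      unfolding cinner_rank_one_sum by (intro sum.cong refl) (simp, subst cinner_commute, simp)
    also have "\<dots> = complex_of_real (\<Sum>i<n. (cmod (cinner v (x i)))\<^sup>2)"
      by (simp add: complex_norm_square[symmetric])
    finally have "(\<Sum>i<n. (cmod (cinner v (x i)))\<^sup>2) = 0"
      by (metis of_real_eq_0_iff)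
    then show "\<forall>i<n. cinner v (x i) = 0"
      by (subst (asm) sum_nonneg_eq_0_iff) auto
  qed (simp add: rank_one_sum_def proj_def)
  then show ?thesis by (auto simp: total_family_def singular_comb_def)
qed

text \<open>The map sending \<open>v\<close> to its inner products with a total family is injective, hence onto. This
  replaces the dual basis.\<close>

lemma total_family_prescribe:
  fixes x :: "nat \<Rightarrow> 'a::complex_inner"
  assumes d: "cdim (UNIV :: 'a set) = n" "n > 0" and x: "total_family n x"
  obtains v where "\<And>i. i < n \<Longrightarrow> cinner v (x i) = g i"
proof -
  obtain u :: 'a where "norm u = 1" using exists_unit[OF d] .
  then obtain e :: "nat \<Rightarrow> 'a" where e: "onb n e" using exists_onb[OF d] by blast
  note comb = orthonormal_cinner_comb[OF onb_orthonormal[OF e]]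
  define F where "F v = (\<Sum>i<n. cinner v (x i) *\<^sub>C e i)" for v
  have "clinear F"
    unfolding clinear_iff F_def
    by (simp add: cinner_add_left cinner_scaleC_left scaleC_add_left sum.distrib
        cvs.scale_sum_right scaleC_scaleC)
  moreover have "v = 0" if "F v = 0" for v
  proof -
    have "cinner v (x i) = 0" if "i < n" for i
      using comb[OF that, of "\<lambda>i. cinner v (x i)"] \<open>F v = 0\<close> by (simp add: F_def)
    with x show ?thesis by (auto simp: total_family_def)
  qed
  ultimately have "surj F" by (rule clinear_inj_imp_surj[OF d])
  then obtain v where v: "F v = (\<Sum>i<n. g i *\<^sub>C e i)" by (metis surjD)
  have "cinner v (x i) = g i" if "i < n" for i
    using arg_cong[OF v, of "\<lambda>y. cinner y (e i)"] comb[OF that] by (simp add: F_def)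
  with that show ?thesis by blast
qed

lemma total_family_independent:
  fixes x :: "nat \<Rightarrow> 'a::complex_inner"
  assumes d: "cdim (UNIV :: 'a set) = n" "n > 0" and x: "total_family n x"
    and s: "(\<Sum>i<n. g i *\<^sub>C x i) = 0" and i: "i < n"
  shows "g i = 0"
proof -
  obtain v where v: "\<And>i. i < n \<Longrightarrow> cinner v (x i) = g i"
    using total_family_prescribe[OF d x] by blast
  have "0 = cinner v (\<Sum>i<n. g i *\<^sub>C x i)" using s by simp
  also have "\<dots> = (\<Sum>i<n. cnj (g i) * g i)"
    unfolding cinner_sum_right by (intro sum.cong refl) (simp add: cinner_scaleC_right v)
  also have "\<dots> = complex_of_real (\<Sum>i<n. (cmod (g i))\<^sup>2)"
    by (simp only: of_real_sum complex_norm_square mult.commute)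
  finally have "(\<Sum>i<n. (cmod (g i))\<^sup>2) = 0"
    by (metis of_real_eq_0_iff)
  with i show ?thesis by (subst (asm) sum_nonneg_eq_0_iff) auto
qed

lemma total_family_spans:
  fixes x :: "nat \<Rightarrow> 'a::complex_inner"
  assumes d: "cdim (UNIV :: 'a set) = n" "n > 0" and x: "total_family n x"
  obtains b where "z = (\<Sum>i<n. b i *\<^sub>C x i)"
proof -
  have "surj (rank_one_sum n (\<lambda>_. 1) x)"
    by (rule clinear_inj_imp_surj[OF d clinear_rank_one_sum])
      (use x in \<open>auto simp: total_family_iff_not_singular singular_comb_def\<close>)
  then obtain v where "z = rank_one_sum n (\<lambda>_. 1) x v" by (metis surjD)
  then have "z = (\<Sum>i<n. cinner v (x i) *\<^sub>C x i)"
    by (simp add: rank_one_sum_def proj_def)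
  then show ?thesis by (rule that)
qed

text \<open>A sequence of \<open>n\<close> entries with one more appended, used both for vectors (a basis and an
  extra vector \<open>z\<close>) and for the weights.\<close>

definition bordered :: "nat \<Rightarrow> (nat \<Rightarrow> 'b) \<Rightarrow> 'b \<Rightarrow> nat \<Rightarrow> 'b" where
  "bordered n x z i = (if i < n then x i else z)"

lemma rank_one_sum_bordered:
  "rank_one_sum (Suc n) (bordered n (\<lambda>i. 1 / d i) (- 1)) (bordered n x z) v
    = (\<Sum>i<n. (cinner v (x i) / d i) *\<^sub>C x i) - cinner v z *\<^sub>C z"
proof -
  have m1: "(- 1) *\<^sub>C w = - w" for w :: 'a by simp
  show ?thesis
    by (simp add: rank_one_sum_def bordered_def proj_def m1 scaleC_scaleC)
qed

text \<open>By independence of the \<open>x\<^sub>i\<close>, a kernel vector \<open>v\<close> satisfies \<open>\<langle>v,x\<^sub>i\<rangle> = \<langle>v,z\<rangle> a\<^sub>i t\<^sub>i\<close>; inserting this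
  into \<open>\<langle>v,z\<rangle> = \<Sum>cnj a\<^sub>i \<langle>v,x\<^sub>i\<rangle>\<close> and cancelling \<open>\<langle>v,z\<rangle>\<close> gives the equation. The weights are inverted
  to make that equation linear in \<open>t\<close>.\<close>

lemma singular_bordered_iff:
  fixes x :: "nat \<Rightarrow> 'a::complex_inner"
  assumes d: "cdim (UNIV :: 'a set) = n" "n > 0" and x: "total_family n x"
    and z: "z = (\<Sum>i<n. a i *\<^sub>C x i)" and t: "\<And>i. i < n \<Longrightarrow> t i \<noteq> 0"
  shows "singular_comb (Suc n) (bordered n (\<lambda>i. 1 / t i) (- 1)) (bordered n x z)
    \<longleftrightarrow> (\<Sum>i<n. complex_of_real ((cmod (a i))\<^sup>2) * t i) = 1"
proof -
  have vz: "cinner v z = (\<Sum>i<n. cnj (a i) * cinner v (x i))" for v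
    by (simp add: z cinner_sum_right cinner_scaleC_right)
  have A: "rank_one_sum (Suc n) (bordered n (\<lambda>i. 1 / t i) (- 1)) (bordered n x z) v
      = (\<Sum>i<n. (cinner v (x i) / t i - cinner v z * a i) *\<^sub>C x i)" for v
  proof -
    have "cinner v z *\<^sub>C z = (\<Sum>i<n. (cinner v z * a i) *\<^sub>C x i)"
      by (subst (2) z) (simp add: cvs.scale_sum_right scaleC_scaleC)
    then show ?thesis
      unfolding rank_one_sum_bordered
      by (simp add: sum_subtractf cvs.scale_left_diff_distrib)
  qed
  show ?thesis
  proof
    assume "singular_comb (Suc n) (bordered n (\<lambda>i. 1 / t i) (- 1)) (bordered n x z)"
    then obtain v where v: "v \<noteq> 0"
        "(\<Sum>i<n. (cinner v (x i) / t i - cinner v z * a i) *\<^sub>C x i) = 0"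
      by (auto simp: singular_comb_def A)
    have vx: "cinner v (x i) = cinner v z * a i * t i" if "i < n" for i
      using total_family_independent[OF d x v(2) that] t[OF that] by (simp add: field_simps)
    have "cinner v z \<noteq> 0"
    proof
      assume "cinner v z = 0"
      then have "v = 0" using x vx by (simp add: total_family_def)
      with v show False by simp
    qed
    have "cinner v z = cinner v z * (\<Sum>i<n. complex_of_real ((cmod (a i))\<^sup>2) * t i)"
      by (subst vz) (simp add: vx sum_distrib_left complex_norm_square mult_ac del: of_real_power)
    with \<open>cinner v z \<noteq> 0\<close> show "(\<Sum>i<n. complex_of_real ((cmod (a i))\<^sup>2) * t i) = 1"
      by (metis mult_cancel_left1)
  next
    assume s: "(\<Sum>i<n. complex_of_real ((cmod (a i))\<^sup>2) * t i) = 1"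
    obtain v where v: "\<And>i. i < n \<Longrightarrow> cinner v (x i) = a i * t i"
      using total_family_prescribe[OF d x, of "\<lambda>i. a i * t i"] by blast
    have "cinner v z = (\<Sum>i<n. complex_of_real ((cmod (a i))\<^sup>2) * t i)"
      by (simp add: vz v complex_norm_square mult_ac del: of_real_power)
    then have "cinner v z = 1" using s by simp
    moreover from this have "v \<noteq> 0" by auto
    moreover have "cinner v (x i) / t i - 1 * a i = 0" if "i < n" for i
      using v[OF that] t[OF that] by simp
    ultimately show "singular_comb (Suc n) (bordered n (\<lambda>i. 1 / t i) (- 1)) (bordered n x z)"
      unfolding singular_comb_def A by (intro exI[of _ v]) simp
  qed
qed

text \<open>The constant point \<open>s = 1 / \<Sum>\<beta>\<close> lies on the \<open>\<beta>\<close>-hyperplane, and moving it by \<open>\<i>\<beta>\<^sub>j\<close> in direction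
  \<open>i\<close> and by \<open>-\<i>\<beta>\<^sub>i\<close> in direction \<open>j\<close> stays on it. The displacement is chosen imaginary because the
  real parts of the coordinates remain \<open>s > 0\<close>, so none of them vanishes. Membership in the
  \<open>\<alpha>\<close>-hyperplane then makes \<open>\<alpha>\<close> proportional to \<open>\<beta>\<close>, and the constant point fixes the factor.\<close>

lemma weights_determined_by_hyperplane:
  fixes \<alpha> \<beta> :: "nat \<Rightarrow> real"
  assumes \<beta>: "(\<Sum>i<n. \<beta> i) > 0"
    and H: "\<And>t. (\<And>i. i < n \<Longrightarrow> t i \<noteq> 0) \<Longrightarrow> (\<Sum>i<n. complex_of_real (\<beta> i) * t i) = 1
      \<Longrightarrow> (\<Sum>i<n. complex_of_real (\<alpha> i) * t i) = 1"
    and i: "i < n"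
  shows "\<alpha> i = \<beta> i"
proof -
  define s where "s = 1 / (\<Sum>i<n. \<beta> i)"
  have s: "s > 0" "s * (\<Sum>i<n. \<beta> i) = 1" using \<beta> by (auto simp: s_def)
  have c0: "(\<Sum>i<n. complex_of_real (\<gamma> i) * complex_of_real s) = complex_of_real (s * (\<Sum>i<n. \<gamma> i))" for \<gamma>
    by (simp add: sum_distrib_left mult.commute)
  have "(\<Sum>i<n. complex_of_real (\<alpha> i) * complex_of_real s) = 1"
    by (rule H) (use s c0[of \<beta>] in auto)
  then have s\<alpha>: "s * (\<Sum>i<n. \<alpha> i) = 1" unfolding c0 using of_real_eq_1_iff by blast
  have eq: "\<alpha> i * \<beta> j = \<alpha> j * \<beta> i" if "i < n" "j < n" for i j
  proof (cases "i = j")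
    case False
    define p where "p k = (if k = i then \<i> * complex_of_real (\<beta> j) else 0)
        + (if k = j then - \<i> * complex_of_real (\<beta> i) else 0)" for k
    have sum: "(\<Sum>k<n. complex_of_real (\<gamma> k) * (complex_of_real s + p k))
        = complex_of_real (s * (\<Sum>k<n. \<gamma> k)) + \<i> * complex_of_real (\<gamma> i * \<beta> j - \<gamma> j * \<beta> i)" for \<gamma>
    proof -
      have "(\<Sum>k<n. complex_of_real (\<gamma> k) * p k)
          = (\<Sum>k<n. if k = i then complex_of_real (\<gamma> k) * (\<i> * complex_of_real (\<beta> j)) else 0)
          + (\<Sum>k<n. if k = j then complex_of_real (\<gamma> k) * (- \<i> * complex_of_real (\<beta> i)) else 0)"
        unfolding sum.distrib[symmetric] by (intro sum.cong refl) (simp add: p_def distrib_left)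
      also have "\<dots> = \<i> * complex_of_real (\<gamma> i * \<beta> j - \<gamma> j * \<beta> i)"
        using that by (simp add: algebra_simps)
      finally show ?thesis by (simp only: distrib_left sum.distrib c0)
    qed
    have "(\<Sum>k<n. complex_of_real (\<alpha> k) * (complex_of_real s + p k)) = 1"
    proof (rule H)
      fix k assume "k < n"
      have "Re (complex_of_real s + p k) = s" by (simp add: p_def)
      then show "complex_of_real s + p k \<noteq> 0" using s(1) by (metis less_irrefl zero_complex.simps(1))
    qed (simp only: sum, simp add: s)
    then have "\<i> * complex_of_real (\<alpha> i * \<beta> j - \<alpha> j * \<beta> i) = 0"
      unfolding sum s\<alpha> by simp
    then have "complex_of_real (\<alpha> i * \<beta> j - \<alpha> j * \<beta> i) = 0" by simp
    then show ?thesis by (simp only: of_real_eq_0_iff)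
  qed simp
  have "\<alpha> i * (\<Sum>j<n. \<beta> j) = (\<Sum>j<n. \<alpha> j) * \<beta> i"
    unfolding sum_distrib_left sum_distrib_right using i by (intro sum.cong refl eq) auto
  then have "\<alpha> i * (s * (\<Sum>j<n. \<beta> j)) = (s * (\<Sum>j<n. \<alpha> j)) * \<beta> i"
    by (simp add: mult_ac)
  then show ?thesis using s(2) s\<alpha> by simp
qed

section \<open>Shrinking maps preserve transition probabilities\<close>

locale shrinking =
  fixes T :: "'a::complex_inner \<Rightarrow> 'a" and n :: nat
  assumes d: "cdim (UNIV :: 'a set) = n" "n > 0"
    and T_norm: "\<And>u. norm u = 1 \<Longrightarrow> norm (T u) = 1"
    and T_shrinks: "\<And>m c u. \<lbrakk>0 < m; m \<le> Suc n; \<And>i. i < m \<Longrightarrow> norm (u i) = 1; singular_comb m c (\<lambda>i. T (u i))\<rbrakk>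
      \<Longrightarrow> singular_comb m c u"
begin

lemma total_image:
  assumes "total_family n x" "\<And>i. i < n \<Longrightarrow> norm (x i) = 1"
  shows "total_family n (\<lambda>i. T (x i))"
  using T_shrinks[of n x] assms d(2) by (auto simp: total_family_iff_not_singular)

lemma coefficient_moduli:
  assumes x: "total_family n x" "\<And>i. i < n \<Longrightarrow> norm (x i) = 1"
    and z: "norm z = 1" "z = (\<Sum>i<n. a i *\<^sub>C x i)" "T z = (\<Sum>i<n. b i *\<^sub>C T (x i))"
    and i: "i < n"
  shows "cmod (a i) = cmod (b i)"
proof -
  note Tx = total_image[OF x]
  have bT: "(\<lambda>i. T (bordered n x z i)) = bordered n (\<lambda>i. T (x i)) (T z)"
    by (auto simp: bordered_def)
  have nz: "(\<Sum>i<n. (cmod (b i))\<^sup>2) > 0"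
  proof (rule ccontr)
    assume "\<not> ?thesis"
    then have "(\<Sum>i<n. (cmod (b i))\<^sup>2) = 0"
      by (metis less_eq_real_def not_less sum_nonneg zero_le_power2)
    then have "b i = 0" if "i < n" for i
      using that by (subst (asm) sum_nonneg_eq_0_iff) auto
    then have "T z = 0" by (simp add: z(3))
    with T_norm[OF z(1)] show False by simp
  qed
  have "(cmod (a i))\<^sup>2 = (cmod (b i))\<^sup>2"
  proof (rule weights_determined_by_hyperplane[OF nz _ i])
    fix t assume t: "\<And>i. i < n \<Longrightarrow> t i \<noteq> (0::complex)"
      and s: "(\<Sum>i<n. complex_of_real ((cmod (b i))\<^sup>2) * t i) = 1"
    have "singular_comb (Suc n) (bordered n (\<lambda>i. 1 / t i) (- 1)) (\<lambda>i. T (bordered n x z i))"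
      unfolding bT using singular_bordered_iff[OF d Tx z(3) t] s by simp
    then have "singular_comb (Suc n) (bordered n (\<lambda>i. 1 / t i) (- 1)) (bordered n x z)"
      by (rule T_shrinks[rotated 3]) (use x(2) z(1) in \<open>auto simp: bordered_def\<close>)
    then show "(\<Sum>i<n. complex_of_real ((cmod (a i))\<^sup>2) * t i) = 1"
      using singular_bordered_iff[OF d x(1) z(2) t] by simp
  qed
  then show ?thesis by (simp add: power2_eq_iff_nonneg)
qed

end

text \<open>Orthonormalize \<open>x, y\<close> to \<open>x, w\<close>, extend to an orthonormal basis, and put \<open>y\<close> back in place
  of \<open>w\<close>.\<close>

lemma two_vectors_in_total_family:
  fixes x y :: "'a::complex_inner"
  assumes d: "cdim (UNIV :: 'a set) = n" "n \<ge> 2" and n: "norm x = 1" "norm y = 1"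
    and ind: "y \<noteq> cinner y x *\<^sub>C x"
  obtains f where "total_family n f" "f 0 = x" "f 1 = y" "\<And>i. i < n \<Longrightarrow> norm (f i) = 1"
proof -
  have d': "n > 0" using d by simp
  define r where "r = y - cinner y x *\<^sub>C x"
  have "r \<noteq> 0" using ind by (simp add: r_def)
  define w where "w = complex_of_real (1 / norm r) *\<^sub>C r"
  have w: "norm w = 1" unfolding w_def by (rule norm_normalized[OF \<open>r \<noteq> 0\<close>])
  have y: "y = cinner y x *\<^sub>C x + complex_of_real (norm r) *\<^sub>C w"
    using \<open>r \<noteq> 0\<close> by (simp add: w_def r_def scaleC_scaleC)
  have o1: "orthonormal 1 (\<lambda>_. x)" by (simp add: orthonormal_def cinner_self n)
  have "cinner w x = 0"
    by (simp add: w_def r_def cinner_scaleC_left cinner_diff_left cinner_self n)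
  then have o2: "orthonormal 2 ((\<lambda>_. x)(1 := w))"
    using orthonormal_snoc[OF o1 w] by (simp add: numeral_2_eq_2)
  have "\<exists>e. orthonormal m e \<and> e 0 = x \<and> e 1 = w" if "2 \<le> m" "m \<le> n" for m
    using that
  proof (induction m rule: dec_induct)
    case base
    have "((\<lambda>_. x)(1 := w)) (0::nat) = x" "((\<lambda>_. x)(1 := w)) (1::nat) = w" by auto
    with o2 show ?case by blast
  next
    case (step m)
    then obtain e where e: "orthonormal m e" "e 0 = x" "e 1 = w" by auto
    from step have "m < n" by simp
    from orthonormal_extend[OF d(1) d' e(1) this] obtain v where v: "orthonormal (Suc m) (e(m := v))" .
    have "(e(m := v)) 0 = x" "(e(m := v)) 1 = w" using e step by auto
    with v show ?case by blast
  qed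
  from this[of n] d obtain e where e: "orthonormal n e" "e 0 = x" "e 1 = w" by auto
  have onb: "onb n e" by (rule orthonormal_cdim_onb[OF d(1) d' e(1)])
  define f where "f = e(1 := y)"
  have "total_family n f"
    unfolding total_family_def
  proof (intro allI impI)
    fix v assume v: "\<forall>i<n. cinner v (f i) = 0"
    have v0: "cinner v x = 0" using v[rule_format, of 0] d' e by (simp add: f_def)
    have "cinner v y = 0" using v[rule_format, of 1] d by (simp add: f_def)
    then have "cinner v (cinner y x *\<^sub>C x + complex_of_real (norm r) *\<^sub>C w) = 0"
      using y by simp
    then have v1: "cinner v w = 0"
      using v0 \<open>r \<noteq> 0\<close> by (simp add: cinner_add_right cinner_scaleC_right)
    show "v = 0"
    proof (rule onb_eqI[OF onb])
      fix i assume "i < n"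
      then show "cinner v (e i) = cinner 0 (e i)"
        using v[rule_format, of i] v1 e by (cases "i = 1") (auto simp: f_def)
    qed
  qed
  moreover have "norm (f i) = 1" if "i < n" for i
    using orthonormal_norm[OF e(1) that] n by (simp add: f_def)
  ultimately show ?thesis by (intro that[of f]) (auto simp: f_def e)
qed

lemma norm_sq_add:
  "(norm (x + y))\<^sup>2 = (norm x)\<^sup>2 + (norm y)\<^sup>2 + 2 * Re (cinner x (y::'a::complex_inner))"
  unfolding Re_cinner by (simp add: power2_norm_eq_inner inner_add_left inner_add_right inner_commute)

context shrinking
begin

text \<open>Of all unit vectors \<open>s x + s \<theta> y\<close>, the one with aligned summands has the smallest \<open>s\<close>, and
  that value encodes \<open>|\<langle>x,y\<rangle>|\<close>. The image is a combination of \<open>T x\<close> and \<open>T y\<close> with the same coefficient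
  moduli, though perhaps no longer aligned; this is where only an inequality survives.\<close>

lemma cinner_le_image:
  assumes n2: "n \<ge> 2" and u: "norm x = 1" "norm y = 1" and ind: "y \<noteq> cinner y x *\<^sub>C x"
  shows "cmod (cinner x y) \<le> cmod (cinner (T x) (T y))"
proof -
  obtain f where f: "total_family n f" "f 0 = x" "f 1 = y" "\<And>i. i < n \<Longrightarrow> norm (f i) = 1"
    using two_vectors_in_total_family[OF d(1) n2 u ind] by blast
  \<comment> \<open>The phase that makes \<open>\<langle>x, \<theta> y\<rangle>\<close> a nonnegative real; any phase does if \<open>\<langle>x,y\<rangle> = 0\<close>.\<close>
  define \<theta> where "\<theta> = (if cinner x y = 0 then 1 else sgn (cinner x y))"
  have \<theta>: "cmod \<theta> = 1" "cnj \<theta> * cinner x y = complex_of_real (cmod (cinner x y))"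
  proof -
    show "cmod \<theta> = 1" by (simp add: \<theta>_def norm_sgn)
    show "cnj \<theta> * cinner x y = complex_of_real (cmod (cinner x y))"
    proof (cases "cinner x y = 0")
      case False
      then have "cnj \<theta> * cinner x y = complex_of_real ((cmod (cinner x y))\<^sup>2) / complex_of_real (cmod (cinner x y))"
        by (simp add: \<theta>_def sgn_div_norm scaleR_conv_of_real complex_norm_square field_simps del: of_real_power)
      also have "\<dots> = complex_of_real (cmod (cinner x y))"
        using False by (simp add: power2_eq_square)
      finally show ?thesis .
    qed simp
  qed
  define s where "s = 1 / sqrt (2 + 2 * cmod (cinner x y))"
  have pos: "2 + 2 * cmod (cinner x y) > 0" by (simp add: add_pos_nonneg)
  then have s: "s > 0" "s\<^sup>2 * (2 + 2 * cmod (cinner x y)) = 1"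
    by (auto simp: s_def power_divide)
  define a where "a i = (if i = 0 then complex_of_real s else if i = 1 then complex_of_real s * \<theta> else 0)" for i :: nat
  have sum2: "(\<Sum>i<n. c i *\<^sub>C g i) = c 0 *\<^sub>C g 0 + c 1 *\<^sub>C g 1" if "\<And>i. 2 \<le> i \<Longrightarrow> i < n \<Longrightarrow> c i = 0"
    for c and g :: "nat \<Rightarrow> 'a"
  proof -
    have "(\<Sum>i<n. c i *\<^sub>C g i) = (\<Sum>i<2. c i *\<^sub>C g i)"
      using n2 that by (intro sum.mono_neutral_right) auto
    then show ?thesis by (simp add: numeral_2_eq_2)
  qed
  define z where "z = (\<Sum>i<n. a i *\<^sub>C f i)"
  have z: "z = complex_of_real s *\<^sub>C x + (complex_of_real s * \<theta>) *\<^sub>C y"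
    unfolding z_def by (subst sum2) (auto simp: a_def f f(3)[unfolded One_nat_def])
  have "(norm z)\<^sup>2 = s\<^sup>2 + s\<^sup>2 + 2 * (s\<^sup>2 * cmod (cinner x y))"
  proof -
    have "cinner (complex_of_real s *\<^sub>C x) ((complex_of_real s * \<theta>) *\<^sub>C y)
        = complex_of_real (s\<^sup>2) * (cnj \<theta> * cinner x y)"
      by (simp add: cinner_scaleC_left cinner_scaleC_right power2_eq_square mult_ac)
    also have "\<dots> = complex_of_real (s\<^sup>2 * cmod (cinner x y))"
      by (simp only: \<theta>(2) of_real_mult)
    finally have "Re (cinner (complex_of_real s *\<^sub>C x) ((complex_of_real s * \<theta>) *\<^sub>C y)) = s\<^sup>2 * cmod (cinner x y)"
      by (simp only: Re_complex_of_real)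
    then show ?thesis
      unfolding z norm_sq_add by (simp add: norm_scaleC norm_mult \<theta> u)
  qed
  also have "\<dots> = 1" using s(2) by (simp add: algebra_simps)
  finally have nz: "norm z = 1" using norm_ge_zero[of z] by (auto simp: power2_eq_1_iff)
  obtain b where b: "T z = (\<Sum>i<n. b i *\<^sub>C T (f i))"
    using total_family_spans[OF d total_image[OF f(1,4)]] by blast
  note ab = coefficient_moduli[OF f(1,4) nz z_def b]
  have b0: "cmod (b 0) = s" "cmod (b 1) = s"
    using ab[of 0] ab[of 1] n2 s(1) \<theta> by (auto simp: a_def norm_mult)
  have "b i = 0" if "2 \<le> i" "i < n" for i
    using ab[of i] that by (simp add: a_def)
  then have Tz: "T z = b 0 *\<^sub>C T x + b 1 *\<^sub>C T y"
    unfolding b by (subst sum2) (auto simp: f f(3)[unfolded One_nat_def])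
  have "1 = (norm (T z))\<^sup>2" using T_norm[OF nz] by simp
  also have "\<dots> = s\<^sup>2 + s\<^sup>2 + 2 * Re (cinner (b 0 *\<^sub>C T x) (b 1 *\<^sub>C T y))"
    unfolding Tz norm_sq_add by (simp add: norm_scaleC b0 b0(2)[unfolded One_nat_def] T_norm u)
  also have "\<dots> \<le> s\<^sup>2 + s\<^sup>2 + 2 * cmod (cinner (b 0 *\<^sub>C T x) (b 1 *\<^sub>C T y))"
    using complex_Re_le_cmod[of "cinner (b 0 *\<^sub>C T x) (b 1 *\<^sub>C T y)"] by simp
  also have "\<dots> = s\<^sup>2 * (2 + 2 * cmod (cinner (T x) (T y)))"
    by (simp only: cinner_scaleC_left cinner_scaleC_right norm_mult complex_mod_cnj b0)
      (simp add: power2_eq_square algebra_simps)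
  finally have "s\<^sup>2 * (2 + 2 * cmod (cinner x y)) \<le> s\<^sup>2 * (2 + 2 * cmod (cinner (T x) (T y)))"
    using s(2) by simp
  then show ?thesis using s(1) by simp
qed

end


locale transition_preserving =
  fixes T :: "'a::complex_inner \<Rightarrow> 'a" and n :: nat
  assumes d: "cdim (UNIV :: 'a set) = n" "n > 0"
    and T_norm: "\<And>u. norm u = 1 \<Longrightarrow> norm (T u) = 1"
    and T_cinner: "\<And>u v. \<lbrakk>norm u = 1; norm v = 1\<rbrakk> \<Longrightarrow> cmod (cinner (T u) (T v)) = cmod (cinner u v)"

lemma cmod_cinner_proj_cong:
  assumes "proj u = proj v" "norm u = 1" "norm v = 1"
  shows "cmod (cinner x u) = cmod (cinner x v)"
  using assms norm_proj[of u x] norm_proj[of v x] by simp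

text \<open>Preimages \<open>e\<close> of an orthonormal basis \<open>f\<close> are orthonormal because \<open>T\<close> does not decrease
  \<open>|\<langle>\<cdot>,\<cdot>\<rangle>|\<close>. Parseval for \<open>x\<close> in \<open>e\<close> and for \<open>T x\<close> in \<open>f\<close> then compares two sums equal to \<open>1\<close>
  term by term, so no term can increase. Taking \<open>f\<^sub>0 = T y\<close> and \<open>e\<^sub>0 = y\<close> gives the claim.\<close>

lemma (in shrinking) transition_preserving_if_surj:
  assumes n2: "n \<ge> 2"
    and T_surj: "\<And>u. norm u = 1 \<Longrightarrow> \<exists>v. norm v = 1 \<and> proj (T v) = proj u"
    and T_cong: "\<And>u v. \<lbrakk>norm u = 1; norm v = 1; proj u = proj v\<rbrakk> \<Longrightarrow> proj (T u) = proj (T v)"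
  shows "transition_preserving T n"
proof
  have le: "cmod (cinner x y) \<le> cmod (cinner (T x) (T y))" if u: "norm x = 1" "norm y = 1" for x y
  proof (cases "y = cinner y x *\<^sub>C x")
    case False
    then show ?thesis by (rule cinner_le_image[OF n2 u])
  next
    case True
    define c where "c = cinner y x"
    have y: "y = c *\<^sub>C x" using True by (simp add: c_def)
    have c: "cmod c = 1" using u by (simp add: y norm_scaleC)
    have "proj y = proj x"
    proof
      fix v
      have "proj y v = (cnj c * c) *\<^sub>C proj x v"
        by (simp add: y proj_def cinner_scaleC_right scaleC_scaleC mult_ac)
      also have "cnj c * c = 1"
        using c by (simp add: mult.commute[of "cnj c"] complex_norm_square[symmetric])
      finally show "proj y v = proj x v" by simp
    qed
    then have "cmod (cinner (T x) (T y)) = cmod (cinner (T x) (T x))"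
      by (intro cmod_cinner_proj_cong T_cong T_norm u)
    also have "\<dots> = 1" by (simp add: cinner_self T_norm u)
    finally show ?thesis using c by (simp add: y cinner_scaleC_right cinner_self u)
  qed
  show "cmod (cinner (T x) (T y)) = cmod (cinner x y)" if u: "norm x = 1" "norm y = 1" for x y
  proof -
    obtain f where f: "onb n f" "f 0 = T y"
      using exists_onb[OF d T_norm[OF u(2)]] by blast
    have f1: "norm (f i) = 1" if "i < n" for i
      using orthonormal_norm[OF onb_orthonormal[OF f(1)] that] .
    have "\<exists>v. norm v = 1 \<and> proj (T v) = proj (f i) \<and> (i = 0 \<longrightarrow> v = y)" if "i < n" for i
      using T_surj[OF f1[OF that]] u(2) f(2) by (cases "i = 0") auto
    then obtain e where e: "\<And>i. i < n \<Longrightarrow> norm (e i) = 1"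
        "\<And>i. i < n \<Longrightarrow> proj (T (e i)) = proj (f i)" "e 0 = y"
      using d(2) by metis
    have Te: "cmod (cinner v (T (e i))) = cmod (cinner v (f i))" if "i < n" for v i
      by (intro cmod_cinner_proj_cong e(2) T_norm e(1) f1 that)
    have "orthonormal n e"
      unfolding orthonormal_def
    proof (intro allI impI)
      fix i j assume ij: "i < n" "j < n"
      show "cinner (e i) (e j) = (if i = j then 1 else 0)"
      proof (cases "i = j")
        case True
        then show ?thesis using e(1)[OF ij(1)] by (simp add: cinner_self)
      next
        case False
        have "cmod (cinner (e i) (e j)) \<le> cmod (cinner (T (e i)) (T (e j)))"
          by (intro le e(1) ij)
        also have "\<dots> = cmod (cinner (f j) (T (e i)))"
          by (simp add: Te ij cmod_cinner_commute[of "f j"])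
        also have "\<dots> = cmod (cinner (f j) (f i))"
          by (simp add: Te ij)
        also have "\<dots> = 0"
          using onb_orthonormal[OF f(1)] ij False by (simp add: orthonormal_def)
        finally show ?thesis using False by simp
      qed
    qed
    then have e_onb: "onb n e" by (rule orthonormal_cdim_onb[OF d])
    have "(\<Sum>i<n. (cmod (cinner (T x) (f i)))\<^sup>2 - (cmod (cinner x (e i)))\<^sup>2) = 0"
      unfolding sum_subtractf onb_norm_sq[OF f(1), symmetric] onb_norm_sq[OF e_onb, symmetric]
      by (simp add: T_norm u)
    moreover have "(cmod (cinner x (e i)))\<^sup>2 \<le> (cmod (cinner (T x) (f i)))\<^sup>2" if "i < n" for i
      using le[OF u(1) e(1)[OF that]] by (simp add: Te that)
    ultimately have "(cmod (cinner (T x) (f 0)))\<^sup>2 - (cmod (cinner x (e 0)))\<^sup>2 = 0"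
      using d(2) by (subst (asm) sum_nonneg_eq_0_iff) auto
    then show ?thesis by (simp add: f(2) e(3) power2_eq_iff_nonneg)
  qed
qed (use d T_norm in auto)

section \<open>Wigner's theorem in finite dimension\<close>

text \<open>Besides the coordinates, the phases of \<open>f\<close> are adapted to \<open>T\<close>: the last condition says that
  \<open>T\<close> sends the diagonal vector \<open>\<Sum>e\<^sub>i\<close> to \<open>\<Sum>f\<^sub>i\<close>, up to scaling and a phase.\<close>

locale adapted_bases = transition_preserving T n
  for T :: "'a::complex_inner \<Rightarrow> 'a" and n +
  fixes e f :: "nat \<Rightarrow> 'a"
  assumes e: "onb n e" and f: "onb n f"
    and coord: "\<And>u i. \<lbrakk>norm u = 1; i < n\<rbrakk> \<Longrightarrow> cmod (cinner (T u) (f i)) = cmod (cinner u (e i))"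
    and coord_sum: "\<And>u. norm u = 1 \<Longrightarrow>
      cmod (\<Sum>i<n. cinner (T u) (f i)) = cmod (\<Sum>i<n. cinner u (e i))"

lemma (in transition_preserving) exists_adapted_bases:
  obtains e f where "adapted_bases T n e f"
proof -
  obtain u :: 'a where "norm u = 1" using exists_unit[OF d] .
  then obtain e :: "nat \<Rightarrow> 'a" where e: "onb n e" using exists_onb[OF d] by blast
  note eo = onb_orthonormal[OF e]
  define g where "g i = T (e i)" for i
  have e1: "norm (e i) = 1" if "i < n" for i by (rule orthonormal_norm[OF eo that])
  have gm: "cmod (cinner (T u) (g i)) = cmod (cinner u (e i))" if "norm u = 1" "i < n" for u i
    unfolding g_def using that by (intro T_cinner e1)
  have go: "orthonormal n g"
    unfolding orthonormal_def
  proof (intro allI impI)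
    fix i j assume ij: "i < n" "j < n"
    show "cinner (g i) (g j) = (if i = j then 1 else 0)"
    proof (cases "i = j")
      case True
      then show ?thesis using T_norm[OF e1[OF ij(1)]] by (simp add: cinner_self g_def)
    next
      case False
      then have "cmod (cinner (g i) (g j)) = 0"
        unfolding g_def using ij by (simp add: T_cinner e1 orthonormal_cinner[OF eo])
      with False show ?thesis by simp
    qed
  qed
  define s where "s = 1 / sqrt (real n)"
  have s: "s > 0" "real n * s\<^sup>2 = 1" using d(2) by (auto simp: s_def power_divide)
  define w where "w = (\<Sum>i<n. complex_of_real s *\<^sub>C e i)"
  have we: "cinner w (e i) = complex_of_real s" if "i < n" for i
    unfolding w_def by (rule orthonormal_cinner_comb[OF eo that])
  have "(norm w)\<^sup>2 = 1" unfolding onb_norm_sq[OF e] using s by (simp add: we)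
  then have w1: "norm w = 1" using norm_ge_zero[of w] by (auto simp: power2_eq_1_iff)
  \<comment> \<open>Absorbing these phases into the basis makes all coordinates of \<open>T w\<close> equal.\<close>
  define p where "p i = cinner (T w) (g i) / complex_of_real s" for i
  have p: "cmod (p i) = 1" if "i < n" for i
    using gm[OF w1 that] we[OF that] s(1) by (simp add: p_def norm_divide)
  define f where "f i = p i *\<^sub>C g i" for i
  have "orthonormal n f"
    unfolding orthonormal_def
  proof (intro allI impI)
    fix i j assume ij: "i < n" "j < n"
    have "cnj (p i) * p i = 1"
      using p[OF ij(1)] by (simp add: mult.commute[of "cnj _"] complex_norm_square[symmetric])
    then show "cinner (f i) (f j) = (if i = j then 1 else 0)"
      by (cases "i = j")
        (simp_all add: f_def cinner_scaleC_left cinner_scaleC_right orthonormal_cinner[OF go] ij mult.commute)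
  qed
  then have fb: "onb n f" by (rule orthonormal_cdim_onb[OF d])
  have wf: "cinner (T w) (f i) = complex_of_real s" if "i < n" for i
  proof -
    have "cinner (T w) (f i) = cnj (p i) * (p i * complex_of_real s)"
      using s(1) by (simp add: f_def cinner_scaleC_right p_def)
    also have "\<dots> = (p i * cnj (p i)) * complex_of_real s" by (simp add: mult_ac)
    also have "p i * cnj (p i) = 1"
      using p[OF that] by (simp add: complex_norm_square[symmetric])
    finally show ?thesis by simp
  qed
  have "adapted_bases T n e f"
  proof
    fix u :: 'a assume u: "norm u = 1"
    show "cmod (cinner (T u) (f i)) = cmod (cinner u (e i))" if "i < n" for i
      using gm[OF u that] p[OF that] by (simp add: f_def cinner_scaleC_right norm_mult)
    have "cinner (T u) (T w) = (\<Sum>i<n. cinner (T u) (f i)) * complex_of_real s"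
      unfolding onb_cinner[OF fb, of "T u" "T w"] sum_distrib_right
      by (intro sum.cong refl) (simp add: wf)
    moreover have "cinner u w = (\<Sum>i<n. cinner u (e i)) * complex_of_real s"
      unfolding onb_cinner[OF e, of u w] sum_distrib_right
      by (intro sum.cong refl) (simp add: we)
    ultimately show "cmod (\<Sum>i<n. cinner (T u) (f i)) = cmod (\<Sum>i<n. cinner u (e i))"
      using T_cinner[OF u w1] s(1) by (simp add: norm_mult)
  qed (rule e fb)+
  then show ?thesis by (rule that)
qed

lemma cmod_add_sq: "(cmod (a + b))\<^sup>2 = (cmod a)\<^sup>2 + (cmod b)\<^sup>2 + 2 * Re (a * cnj b)"
  unfolding cmod_power2 by (simp add: power2_eq_square algebra_simps)

lemma sum_two_support:
  assumes "i < n" "j < n" "i \<noteq> j" "\<And>k::nat. \<lbrakk>k < n; k \<noteq> i; k \<noteq> j\<rbrakk> \<Longrightarrow> h k = 0"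
  shows "(\<Sum>k<n. h k) = h i + (h j :: 'b::comm_monoid_add)"
proof -
  have "(\<Sum>k<n. h k) = (\<Sum>k\<in>{i,j}. h k)"
    using assms by (intro sum.mono_neutral_right) auto
  then show ?thesis using assms(3) by simp
qed

context adapted_bases
begin

lemma orthonormal_e: "orthonormal n e" and orthonormal_f: "orthonormal n f"
  using onb_orthonormal e f by auto

text \<open>Testing with \<open>v = (e\<^sub>i + c e\<^sub>j)/\<surd>2\<close>: its image is \<open>(f\<^sub>i + l f\<^sub>j)/\<surd>2\<close> up to a phase, the coordinate
  sum forces \<open>|1 + l| = |1 + c|\<close>, that is \<open>Re l = Re c\<close>, and equality of \<open>|\<langle>T u,T v\<rangle>|\<close> and \<open>|\<langle>u,v\<rangle>|\<close> becomes
  the last clause. The point is that \<open>l\<close> does not depend on \<open>u\<close>.\<close>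

lemma two_coordinate_test:
  assumes ij: "i < n" "j < n" "i \<noteq> j" and c: "cmod c = 1"
  obtains l where "cmod l = 1" "Re l = Re c"
    "\<And>u. norm u = 1 \<Longrightarrow> Re (l * (cinner (T u) (f i) * cnj (cinner (T u) (f j))))
      = Re (c * (cinner u (e i) * cnj (cinner u (e j))))"
proof -
  define s where "s = 1 / sqrt 2"
  have s: "s > 0" "s\<^sup>2 = 1 / 2" by (auto simp: s_def power_divide)
  define v where "v = complex_of_real s *\<^sub>C e i + (complex_of_real s * c) *\<^sub>C e j"
  have ve: "cinner v (e k) = (if k = i then complex_of_real s else if k = j then complex_of_real s * c else 0)"
    if "k < n" for k
    using ij that by (simp add: v_def cinner_add_left cinner_scaleC_left orthonormal_cinner[OF orthonormal_e])
  have "(norm v)\<^sup>2 = (cmod (cinner v (e i)))\<^sup>2 + (cmod (cinner v (e j)))\<^sup>2"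
    unfolding onb_norm_sq[OF e] by (rule sum_two_support[OF ij]) (simp add: ve)
  then have "(norm v)\<^sup>2 = 1" using ij c s by (simp add: ve norm_mult power_mult_distrib)
  then have v1: "norm v = 1" using norm_ge_zero[of v] by (auto simp: power2_eq_1_iff)
  define a b where "a = cinner (T v) (f i)" and "b = cinner (T v) (f j)"
  have ab: "cmod a = s" "cmod b = s"
    using coord[OF v1] ij s c by (auto simp: a_def b_def ve norm_mult)
  have "a \<noteq> 0" using ab s by auto
  have z: "cinner (T v) (f k) = 0" if "k < n" "k \<noteq> i" "k \<noteq> j" for k
    using coord[OF v1 that(1)] that by (simp add: ve)
  define l where "l = b / a"
  have b: "b = l * a" using \<open>a \<noteq> 0\<close> by (simp add: l_def)
  have l1: "cmod l = 1" using ab s by (simp add: l_def norm_divide)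
  have "cmod (a + b) = cmod (complex_of_real s + complex_of_real s * c)"
  proof -
    have "(\<Sum>k<n. cinner (T v) (f k)) = a + b"
      unfolding a_def b_def by (rule sum_two_support[OF ij]) (simp add: z)
    moreover have "(\<Sum>k<n. cinner v (e k)) = complex_of_real s + complex_of_real s * c"
      by (subst sum_two_support[OF ij]) (use ij in \<open>auto simp: ve\<close>)
    ultimately show ?thesis using coord_sum[OF v1] by simp
  qed
  moreover have "a + b = a * (1 + l)" by (simp add: b algebra_simps)
  moreover have "complex_of_real s + complex_of_real s * c = complex_of_real s * (1 + c)"
    by (simp add: algebra_simps)
  ultimately have "cmod (1 + l) = cmod (1 + c)" using ab s by (simp add: norm_mult)
  then have "Re l = Re c" using cmod_add_sq[of 1 l] cmod_add_sq[of 1 c] l1 c by simp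
  moreover have "Re (l * (cinner (T u) (f i) * cnj (cinner (T u) (f j))))
      = Re (c * (cinner u (e i) * cnj (cinner u (e j))))" if u: "norm u = 1" for u
  proof -
    define x x' y y' where xy: "x = cinner u (e i)" "x' = cinner u (e j)"
      "y = cinner (T u) (f i)" "y' = cinner (T u) (f j)"
    have m: "cmod y = cmod x" "cmod y' = cmod x'" using coord[OF u] ij by (auto simp: xy)
    have "cinner (T u) (T v) = y * cnj a + y' * cnj b"
      unfolding onb_cinner[OF f, of "T u" "T v"] xy a_def b_def
      by (rule sum_two_support[OF ij]) (simp add: z)
    also have "\<dots> = cnj a * (y + y' * cnj l)" by (simp add: b algebra_simps)
    finally have 1: "cmod (cinner (T u) (T v)) = s * cmod (y + y' * cnj l)"
      by (simp add: norm_mult ab)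
    have "cinner u v = x * cnj (complex_of_real s) + x' * cnj (complex_of_real s * c)"
      unfolding onb_cinner[OF e, of u v] xy
      by (subst sum_two_support[OF ij]) (use ij in \<open>auto simp: ve\<close>)
    also have "\<dots> = complex_of_real s * (x + x' * cnj c)" by (simp add: algebra_simps)
    finally have 2: "cmod (cinner u v) = s * cmod (x + x' * cnj c)"
      using s by (simp add: norm_mult)
    have "cmod (y + y' * cnj l) = cmod (x + x' * cnj c)"
      using 1 2 T_cinner[OF u v1] s by simp
    then have "Re (y * cnj (y' * cnj l)) = Re (x * cnj (x' * cnj c))"
      using cmod_add_sq[of y "y' * cnj l"] cmod_add_sq[of x "x' * cnj c"] m l1 c
      by (simp add: norm_mult)
    then show ?thesis unfolding xy by (simp add: mult_ac)
  qed
  ultimately show ?thesis using that l1 by blast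
qed

definition straight :: "nat \<Rightarrow> nat \<Rightarrow> bool" where
  "straight i j \<longleftrightarrow> (\<forall>u. norm u = 1 \<longrightarrow>
     cinner (T u) (f i) * cnj (cinner (T u) (f j)) = cinner u (e i) * cnj (cinner u (e j)))"

definition conjugated :: "nat \<Rightarrow> nat \<Rightarrow> bool" where
  "conjugated i j \<longleftrightarrow> (\<forall>u. norm u = 1 \<longrightarrow>
     cinner (T u) (f i) * cnj (cinner (T u) (f j)) = cnj (cinner u (e i) * cnj (cinner u (e j))))"

text \<open>The test value \<open>c = 1\<close> gives \<open>l = 1\<close> and hence the real parts; \<open>c = \<i>\<close> leaves \<open>l = \<plusminus>\<i>\<close> and
  hence the imaginary parts up to one sign, common to all \<open>u\<close>.\<close>

lemma straight_or_conjugated: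
  assumes ij: "i < n" "j < n" "i \<noteq> j"
  shows "straight i j \<or> conjugated i j"
proof -
  have Re: "Re (cinner (T u) (f i) * cnj (cinner (T u) (f j))) = Re (cinner u (e i) * cnj (cinner u (e j)))"
    if "norm u = 1" for u
  proof -
    obtain l where l: "cmod l = 1" "Re l = Re 1"
      "\<And>u. norm u = 1 \<Longrightarrow> Re (l * (cinner (T u) (f i) * cnj (cinner (T u) (f j))))
        = Re (1 * (cinner u (e i) * cnj (cinner u (e j))))"
      using two_coordinate_test[OF ij, of 1] by auto
    have "(Im l)\<^sup>2 = 0" using l(1,2) cmod_power2[of l] by simp
    then have "l = 1" using l(2) by (simp add: complex_eq_iff)
    with l(3)[OF that] show ?thesis by simp
  qed
  obtain l where l: "cmod l = 1" "Re l = Re \<i>"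
    "\<And>u. norm u = 1 \<Longrightarrow> Re (l * (cinner (T u) (f i) * cnj (cinner (T u) (f j))))
      = Re (\<i> * (cinner u (e i) * cnj (cinner u (e j))))"
    using two_coordinate_test[OF ij, of \<i>] by auto
  have "(Im l)\<^sup>2 = 1" using l(1,2) cmod_power2[of l] by simp
  then have "l = \<i> \<or> l = - \<i>" using l(2) by (auto simp: complex_eq_iff power2_eq_1_iff)
  then show ?thesis
  proof
    assume "l = \<i>"
    then have "Im (cinner (T u) (f i) * cnj (cinner (T u) (f j))) = Im (cinner u (e i) * cnj (cinner u (e j)))"
      if "norm u = 1" for u
      using l(3)[OF that] by (simp only: Re_i_times neg_equal_iff_equal)
    then have "straight i j"
      unfolding straight_def using Re by (blast intro: complex_eqI)
    then show ?thesis ..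
  next
    assume "l = - \<i>"
    then have "Im (cinner (T u) (f i) * cnj (cinner (T u) (f j))) = - Im (cinner u (e i) * cnj (cinner u (e j)))"
      if "norm u = 1" for u
      using l(3)[OF that] by (simp only: Re_i_times mult_minus_left uminus_complex.sel minus_minus)
    then have "conjugated i j"
      unfolding conjugated_def using Re by (intro allI impI complex_eqI) (simp_all only: cnj.sel)
    then show ?thesis ..
  qed
qed

lemma diagonal: "i < n \<Longrightarrow> straight i i \<and> conjugated i i"
  unfolding straight_def conjugated_def
  using coord by (simp add: complex_norm_square[symmetric])

lemma conjugated_sym: "conjugated i j \<Longrightarrow> conjugated j i"
  unfolding conjugated_def
  by (metis (no_types, lifting) complex_cnj_cnj complex_cnj_mult mult.commute)

text \<open>The products satisfy \<open>(u\<^sub>i cnj u\<^sub>j) (u\<^sub>j cnj u\<^sub>k) = |u\<^sub>j|\<^sup>2 u\<^sub>i cnj u\<^sub>k\<close>, for \<open>T u\<close> as well. For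
  \<open>u = (e\<^sub>i + \<i>e\<^sub>j - e\<^sub>k)/\<surd>3\<close> the right side is real, so its type does not matter, while conjugating one
  of the two imaginary factors on the left changes the sign.\<close>

lemma mixed_types_impossible:
  assumes i: "i < n" "j < n" "k < n" "i \<noteq> j" "j \<noteq> k" "i \<noteq> k"
    and R: "conjugated i j" and L: "straight j k"
  shows False
proof -
  define s where "s = 1 / sqrt 3"
  have s: "s > 0" "s\<^sup>2 = 1 / 3" by (auto simp: s_def power_divide)
  define S where "S = complex_of_real s"
  have "S \<noteq> 0" using s by (simp add: S_def)
  define u where "u = S *\<^sub>C e i + (S * \<i>) *\<^sub>C e j + (- S) *\<^sub>C e k"
  have ue: "cinner u (e i) = S" "cinner u (e j) = S * \<i>" "cinner u (e k) = - S"
    using i by (simp_all add: u_def cinner_add_left cinner_scaleC_left cinner_diff_left orthonormal_cinner[OF orthonormal_e])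
  have uz: "cinner u (e m) = 0" if "m < n" "m \<notin> {i,j,k}" for m
    using i that by (simp add: u_def cinner_add_left cinner_scaleC_left cinner_diff_left orthonormal_cinner[OF orthonormal_e])
  have "(norm u)\<^sup>2 = (\<Sum>m\<in>{i,j,k}. (cmod (cinner u (e m)))\<^sup>2)"
    unfolding onb_norm_sq[OF e] using i by (intro sum.mono_neutral_right) (auto simp: uz)
  also have "\<dots> = 1" using i s by (simp add: ue S_def norm_mult)
  finally have u1: "norm u = 1" using norm_ge_zero[of u] by (auto simp: power2_eq_1_iff)
  define x y z where "x = cinner (T u) (f i)" and "y = cinner (T u) (f j)" and "z = cinner (T u) (f k)"
  have cS: "cnj S = S" by (simp add: S_def)
  have 1: "x * cnj y = \<i> * S * S"
    using R u1 unfolding conjugated_def x_def y_def by (simp add: ue cS mult_ac)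
  have 2: "y * cnj z = - \<i> * S * S"
    using L u1 unfolding straight_def z_def y_def by (simp add: ue cS mult_ac)
  have 3: "x * cnj z = - S * S"
    using straight_or_conjugated[of i k] i u1 unfolding straight_def conjugated_def z_def x_def
    by (auto simp: ue cS)
  have 4: "cnj y * y = S * S"
    using diagonal[OF i(2)] u1 unfolding straight_def y_def by (simp add: ue cS mult_ac)
  have "(x * cnj y) * (y * cnj z) = (x * cnj z) * (cnj y * y)" by (simp add: mult_ac)
  then have "S * S * (S * S) = - (S * S * (S * S))"
    unfolding 1 2 3 4 by (simp add: algebra_simps)
  then show False using \<open>S \<noteq> 0\<close> by simp
qed

lemma all_straight_or_all_conjugated:
  "(\<forall>i<n. \<forall>j<n. straight i j) \<or> (\<forall>i<n. \<forall>j<n. conjugated i j)"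
proof (unfold disj_imp, rule impI)
  assume "\<not> (\<forall>i<n. \<forall>j<n. straight i j)"
  then obtain i j where ij: "i < n" "j < n" "\<not> straight i j" by auto
  then have "i \<noteq> j" using diagonal by auto
  have Rij: "conjugated i j" using straight_or_conjugated ij \<open>i \<noteq> j\<close> by blast
  have Rj: "conjugated j l" if l: "l < n" for l
  proof (cases "l = i \<or> l = j")
    case True
    then show ?thesis using Rij diagonal[OF ij(2)] by (auto intro: conjugated_sym)
  next
    case False
    then have "\<not> straight j l" using mixed_types_impossible[OF ij(1,2) l] \<open>i \<noteq> j\<close> Rij by blast
    then show ?thesis using straight_or_conjugated[OF ij(2) l] False by blast
  qed
  show "\<forall>k<n. \<forall>l<n. conjugated k l"
  proof (intro allI impI)
    fix k l assume kl: "k < n" "l < n"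
    consider "k = l" | "k = j" | "l = j" | "k \<noteq> l" "k \<noteq> j" "l \<noteq> j" by blast
    then show "conjugated k l"
    proof cases
      case 4
      then have "\<not> straight k l"
        using mixed_types_impossible[OF ij(2) kl] Rj[OF kl(1)] by blast
      then show ?thesis using straight_or_conjugated[OF kl] 4 by blast
    qed (use diagonal Rj kl conjugated_sym in auto)
  qed
qed

text \<open>The numbers \<open>\<langle>p,f\<^sub>i\<rangle> cnj \<langle>p,f\<^sub>j\<rangle>\<close> are the matrix entries of \<open>proj p\<close>.\<close>

lemma proj_eq_from_coordinates:
  assumes "\<And>i j. \<lbrakk>i < n; j < n\<rbrakk> \<Longrightarrow>
    cinner p (f i) * cnj (cinner p (f j)) = cinner q (f i) * cnj (cinner q (f j))"
  shows "proj p = proj q"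
proof
  fix x
  have *: "cinner (proj p x) (f i) = (\<Sum>j<n. cinner x (f j) * (cinner p (f i) * cnj (cinner p (f j))))" for p i
    unfolding proj_def cinner_scaleC_left onb_cinner[OF f, of x p]
    by (simp add: sum_distrib_left mult_ac)
  show "proj p x = proj q x"
    by (rule onb_eqI[OF f]) (simp add: * assms)
qed

lemma wigner_bases:
  "(\<forall>u. norm u = 1 \<longrightarrow> proj (T u) = proj (\<Sum>i<n. cinner u (e i) *\<^sub>C f i)) \<or>
   (\<forall>u. norm u = 1 \<longrightarrow> proj (T u) = proj (\<Sum>i<n. cnj (cinner u (e i)) *\<^sub>C f i))"
  using all_straight_or_all_conjugated
proof
  assume L: "\<forall>i<n. \<forall>j<n. straight i j"
  have "proj (T u) = proj (\<Sum>i<n. cinner u (e i) *\<^sub>C f i)" if "norm u = 1" for u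
    by (rule proj_eq_from_coordinates)
      (use L that in \<open>simp add: straight_def orthonormal_cinner_comb[OF orthonormal_f]\<close>)
  then show ?thesis by blast
next
  assume R: "\<forall>i<n. \<forall>j<n. conjugated i j"
  have "proj (T u) = proj (\<Sum>i<n. cnj (cinner u (e i)) *\<^sub>C f i)" if "norm u = 1" for u
    by (rule proj_eq_from_coordinates)
      (use R that in \<open>simp add: conjugated_def orthonormal_cinner_comb[OF orthonormal_f]\<close>)
  then show ?thesis by blast
qed

end


section \<open>The equivalence\<close>

lemma onb_coordinate_map:
  fixes e f :: "nat \<Rightarrow> 'a::complex_inner"
  assumes e: "onb n e" and f: "onb n f" and W: "\<And>x. W x = (\<Sum>i<n. cinner x (f i) *\<^sub>C e i)"
    and V: "\<And>x. V x = (\<Sum>i<n. cinner x (e i) *\<^sub>C f i)"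
  shows "W (V x) = x" and "cinner (W x) y = cinner x (V y)"
proof -
  note ce = orthonormal_cinner_comb[OF onb_orthonormal[OF e]]
  note cf = orthonormal_cinner_comb[OF onb_orthonormal[OF f]]
  show "W (V x) = x"
    by (rule onb_eqI[OF e]) (simp add: W V ce cf)
  show "cinner (W x) y = cinner x (V y)"
    unfolding onb_cinner[OF e, of "W x" y] onb_cinner[OF f, of x "V y"]
    by (simp add: W V ce cf)
qed

lemma unitary_from_bases:
  fixes e f :: "nat \<Rightarrow> 'a::complex_inner"
  assumes d: "cdim (UNIV :: 'a set) = n" "n > 0" and e: "onb n e" and f: "onb n f"
  obtains U where "unitary_op U" "\<And>x. cadjoint U x = (\<Sum>i<n. cinner x (e i) *\<^sub>C f i)"
proof -
  define W where "W x = (\<Sum>i<n. cinner x (f i) *\<^sub>C e i)" for x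
  define V where "V x = (\<Sum>i<n. cinner x (e i) *\<^sub>C f i)" for x
  have WV: "W (V x) = x" and VW: "V (W x) = x" and ad: "cinner (W x) y = cinner x (V y)" for x y
    using onb_coordinate_map[OF e f W_def V_def] onb_coordinate_map[OF f e V_def W_def] by blast+
  have "clinear W"
    unfolding clinear_iff W_def
    by (simp add: cinner_add_left cinner_scaleC_left scaleC_add_left sum.distrib
        cvs.scale_sum_right scaleC_scaleC)
  then have "bounded_clinear W" by (rule clinear_bounded[OF d])
  moreover have "cadjoint W = V" by (rule cadjoint_eqI[OF ad])
  ultimately show ?thesis
    using WV VW by (intro that[of W]) (auto simp: unitary_op_def fun_eq_iff V_def)
qed

lemma anti_unitary_from_bases:
  fixes e f :: "nat \<Rightarrow> 'a::complex_inner"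
  assumes e: "onb n e" and f: "onb n f"
  obtains U where "anti_unitary_op U" "\<And>x. inv U x = (\<Sum>i<n. cnj (cinner x (e i)) *\<^sub>C f i)"
proof -
  note ce = orthonormal_cinner_comb[OF onb_orthonormal[OF e]]
  note cf = orthonormal_cinner_comb[OF onb_orthonormal[OF f]]
  define W where "W x = (\<Sum>i<n. cnj (cinner x (f i)) *\<^sub>C e i)" for x
  define V where "V x = (\<Sum>i<n. cnj (cinner x (e i)) *\<^sub>C f i)" for x
  have WV: "W (V x) = x" for x
    by (rule onb_eqI[OF e]) (simp add: W_def V_def ce cf)
  have VW: "V (W x) = x" for x
    by (rule onb_eqI[OF f]) (simp add: W_def V_def ce cf)
  have "W (x + y) = W x + W y" for x y
    by (simp add: W_def cinner_add_left scaleC_add_left sum.distrib)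
  moreover have "W (c *\<^sub>C x) = cnj c *\<^sub>C W x" for c x
    by (simp add: W_def cinner_scaleC_left cvs.scale_sum_right scaleC_scaleC)
  moreover have "surj W" using WV by (rule surjI)
  moreover have "norm (W x) = norm x" for x
  proof -
    have "(norm (W x))\<^sup>2 = (norm x)\<^sup>2"
      unfolding onb_norm_sq[OF e, of "W x"] onb_norm_sq[OF f, of x] by (simp add: W_def ce)
    then show ?thesis by simp
  qed
  ultimately have "anti_unitary_op W" by (simp add: anti_unitary_op_def)
  moreover have "inv W = V" by (rule inv_unique_comp) (auto simp: fun_eq_iff WV VW)
  ultimately show ?thesis by (intro that[of W]) (auto simp: V_def)
qed

lemma shrinks_imp_unitary_or_anti_unitary:
  fixes \<phi> :: "('a::complex_inner \<Rightarrow> 'a) \<Rightarrow> ('a \<Rightarrow> 'a)"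
  assumes dim: "cdim (UNIV :: 'a set) = n" and n: "2 \<le> n" and k: "n + 1 \<le> k"
    and surj: "\<phi> ` rank_one_projections = rank_one_projections"
    and shr: "shrinks_joint_spectrum \<phi> k"
  shows "\<exists>U. (unitary_op U \<and> (\<forall>P\<in>rank_one_projections. \<phi> P = cadjoint U \<circ> P \<circ> U)) \<or>
             (anti_unitary_op U \<and> (\<forall>P\<in>rank_one_projections. \<phi> P = inv U \<circ> P \<circ> U))"
proof -
  have n0: "n > 0" using n by simp
  have ex: "\<exists>v. norm v = 1 \<and> \<phi> (proj u) = proj v" if "norm u = 1" for u
  proof -
    have "\<phi> (proj u) \<in> rank_one_projections"
      using surj proj_in_rank_one_projections[OF dim n0 that] by blast
    then show ?thesis by (rule rank_one_projection_is_proj) blast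
  qed
  define T where "T u = (SOME v. norm v = 1 \<and> \<phi> (proj u) = proj v)" for u
  have T: "norm (T u) = 1" "\<phi> (proj u) = proj (T u)" if "norm u = 1" for u
    using someI_ex[OF ex[OF that]] by (auto simp: T_def)
  interpret shrinking T n
  proof
    fix m c and u :: "nat \<Rightarrow> 'a"
    assume m: "0 < m" "m \<le> Suc n" "\<And>i. i < m \<Longrightarrow> norm (u i) = 1" "singular_comb m c (\<lambda>i. T (u i))"
    have "m \<le> k" using m(2) k by simp
    from shrinks_singular_comb[OF dim n0 shr this m(1) T(2) m(3,4)]
    show "singular_comb m c u" .
  qed (use dim n0 T in auto)
  have "transition_preserving T n"
  proof (rule transition_preserving_if_surj[OF n])
    fix u :: 'a assume "norm u = 1"
    then have "proj u \<in> \<phi> ` rank_one_projections"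
      using surj proj_in_rank_one_projections[OF dim n0] by simp
    then obtain P where P: "P \<in> rank_one_projections" "\<phi> P = proj u" by auto
    obtain v where "norm v = 1" "P = proj v"
      by (rule rank_one_projection_is_proj[OF P(1)])
    with P(2) T(2) show "\<exists>v. norm v = 1 \<and> proj (T v) = proj u" by metis
  next
    fix u v :: 'a assume "norm u = 1" "norm v = 1" "proj u = proj v"
    with T(2) show "proj (T u) = proj (T v)" by metis
  qed
  then obtain e f where "adapted_bases T n e f"
    by (rule transition_preserving.exists_adapted_bases)
  then interpret ab: adapted_bases T n e f .
  show ?thesis
    using ab.wigner_bases
  proof
    assume W: "\<forall>u. norm u = 1 \<longrightarrow> proj (T u) = proj (\<Sum>i<n. cinner u (e i) *\<^sub>C f i)"
    obtain U where U: "unitary_op U" "\<And>x. cadjoint U x = (\<Sum>i<n. cinner x (e i) *\<^sub>C f i)"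
      using unitary_from_bases[OF dim n0 ab.e ab.f] by blast
    have "\<phi> P = cadjoint U \<circ> P \<circ> U" if P: "P \<in> rank_one_projections" for P
    proof -
      obtain u where "norm u = 1" "P = proj u"
        by (rule rank_one_projection_is_proj[OF P])
      then show ?thesis
        using T(2) W unitary_conjugation_proj(1)[OF dim n0 U(1), of u] U(2) by simp
    qed
    with U(1) show ?thesis by blast
  next
    assume W: "\<forall>u. norm u = 1 \<longrightarrow> proj (T u) = proj (\<Sum>i<n. cnj (cinner u (e i)) *\<^sub>C f i)"
    obtain U where U: "anti_unitary_op U" "\<And>x. inv U x = (\<Sum>i<n. cnj (cinner x (e i)) *\<^sub>C f i)"
      using anti_unitary_from_bases[OF ab.e ab.f] by blast
    have "\<phi> P = inv U \<circ> P \<circ> U" if P: "P \<in> rank_one_projections" for P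
    proof -
      obtain u where "norm u = 1" "P = proj u"
        by (rule rank_one_projection_is_proj[OF P])
      then show ?thesis
        using T(2) W anti_unitary_conjugation_proj(1)[OF dim n0 U(1), of u] U(2) by simp
    qed
    with U(1) show ?thesis by blast
  qed
qed

lemma unitary_or_anti_unitary_preserves:
  fixes \<phi> :: "('a::complex_inner \<Rightarrow> 'a) \<Rightarrow> ('a \<Rightarrow> 'a)"
  assumes d: "cdim (UNIV :: 'a set) = n" "n > 0"
    and U: "(unitary_op U \<and> (\<forall>P\<in>rank_one_projections. \<phi> P = cadjoint U \<circ> P \<circ> U)) \<or>
      (anti_unitary_op U \<and> (\<forall>P\<in>rank_one_projections. \<phi> P = inv U \<circ> P \<circ> U))"
  shows "preserves_joint_spectrum \<phi> k"
  using U
proof (elim disjE conjE)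
  assume U: "unitary_op U" "\<forall>P\<in>rank_one_projections. \<phi> P = cadjoint U \<circ> P \<circ> U"
  show ?thesis
    by (rule preserves_joint_spectrumI[OF d, of \<phi> "cadjoint U"])
      (use U unitary_conjugation_proj[OF d U(1)] proj_in_rank_one_projections[OF d] in auto)
next
  assume U: "anti_unitary_op U" "\<forall>P\<in>rank_one_projections. \<phi> P = inv U \<circ> P \<circ> U"
  show ?thesis
    by (rule preserves_joint_spectrumI[OF d, of \<phi> "inv U"])
      (use U anti_unitary_conjugation_proj[OF d U(1)] proj_in_rank_one_projections[OF d] in auto)
qed

lemma preserves_imp_shrinks: "preserves_joint_spectrum \<phi> k \<Longrightarrow> shrinks_joint_spectrum \<phi> k"
  by (simp add: preserves_joint_spectrum_def shrinks_joint_spectrum_def)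

theorem theorem1p4:
  fixes \<phi> :: "('h::complex_hilbert \<Rightarrow> 'h) \<Rightarrow> ('h \<Rightarrow> 'h)"
    and n :: nat
  assumes dim: "cdim (UNIV :: 'h set) = n"
    and n: "3 \<le> n"
    and surj: "\<phi> ` rank_one_projections = rank_one_projections"
  shows "let
      S1 = (\<exists>k\<^sub>0\<ge>n + 1. shrinks_joint_spectrum \<phi> k\<^sub>0);
      S2 = (\<exists>k\<^sub>0\<ge>n + 1. preserves_joint_spectrum \<phi> k\<^sub>0);
      S3 = (\<forall>k\<ge>n + 1. shrinks_joint_spectrum \<phi> k);
      S4 = (\<forall>k\<ge>n + 1. preserves_joint_spectrum \<phi> k);
      S5 = (\<exists>U. (unitary_op U \<and> (\<forall>P\<in>rank_one_projections. \<phi> P = cadjoint U \<circ> P \<circ> U)) \<or>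
                (anti_unitary_op U \<and> (\<forall>P\<in>rank_one_projections. \<phi> P = inv U \<circ> P \<circ> U)))
    in (S1 \<longleftrightarrow> S2) \<and> (S2 \<longleftrightarrow> S3) \<and> (S3 \<longleftrightarrow> S4) \<and> (S4 \<longleftrightarrow> S5)"
proof -
  define S5 where "S5 \<longleftrightarrow>
    (\<exists>U. (unitary_op U \<and> (\<forall>P\<in>rank_one_projections. \<phi> P = cadjoint U \<circ> P \<circ> U)) \<or>
         (anti_unitary_op U \<and> (\<forall>P\<in>rank_one_projections. \<phi> P = inv U \<circ> P \<circ> U)))"
  have n2: "2 \<le> n" "0 < n" using n by simp_all
  have 15: S5 if "n + 1 \<le> k" "shrinks_joint_spectrum \<phi> k" for k
    unfolding S5_def by (rule shrinks_imp_unitary_or_anti_unitary[OF dim n2(1) that(1) surj that(2)])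
  have 54: "preserves_joint_spectrum \<phi> k" if S5 for k
    using that unfolding S5_def by (elim exE) (rule unitary_or_anti_unitary_preserves[OF dim n2(2)])
  show ?thesis
    unfolding Let_def S5_def[symmetric]
    using 15 54 preserves_imp_shrinks by (metis order_refl)
qed

end
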